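(* Let $G$ be an (infinite) 1-ended Cayley graph with a finite presentation $\mathcal{P}$. Then $p_{\mathbb{C}}\le 1-1/\gamma_{\mathcal{P}}$ for bond percolation on $G$, where $\gamma_{\mathcal{P}}=\big((2d-2)^{m_{\mathcal{P}}}-1\big)e$, $d$ is the degree of $G$, $m_{\mathcal{P}}=\lfloor t/2\rfloor$, $t$ is the length of the longest cycle of $G$ induced by a relator of $\mathcal{P}$, and $e$ is Euler's number.
   Context: $G$ is the Cayley graph of the group defined by the finite presentation $\mathcal{P}=\langle\mathcal{S}\mid\mathcal{R}\rangle$ with respect to the generating set $\mathcal{S}$. The closed walks of $G$ induced by the relators in $\mathcal{R}$ (starting at any vertex) are assumed to be cycles of $G$. In Bernoulli bond percolation with parameter $p$ each edge is independently occupied with probability $p$ and vacant otherwise; $\Pr_p$ is the law. For a fixed vertex $o$, $C(o)$ is the connected component of $o$ in the subgraph of occupied edges, $\theta_o(p):=\Pr_p(|C(o)|=\infty)$, and $p_{\mathbb{C}}:=\inf\{p\le 1 : \theta_o \text{ is analytic in } (p,1]\}$. A function $f$ is analytic on an interval $I\subset\mathbb{R}$ if every $x\in I$ is the centre of an open disc $D\subset\mathbb{C}$ on which there is a holomorphic function agreeing with $f$ on $D\cap I$. *)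

theory Defs
  imports "HOL-Probability.Probability" "HOL-Complex_Analysis.Complex_Analysis" "HOL-Algebra.Group"
begin

section \<open>Finite presentations and their Cayley graphs\<close>

text \<open>
  A letter \<open>(s, True)\<close> stands for the generator \<open>s\<close> and \<open>(s, False)\<close> for its formal inverse.
\<close>

type_synonym 'a letter = "'a \<times> bool"
type_synonym 'a gword = "'a letter list"

definition words :: "'a set \<Rightarrow> 'a gword set" where
  "words S = lists (S \<times> UNIV)"

text \<open>
  Two words represent the same element of the group \<open>\<langle>S | R\<rangle>\<close> iff one is obtained from the other by
  finitely many insertions and deletions of relators and of pairs of mutually inverse letters.
\<close>

inductive pres_eq :: "'a set \<Rightarrow> 'a gword set \<Rightarrow> 'a gword \<Rightarrow> 'a gword \<Rightarrow> bool"
  for S R where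
  refl: "u \<in> words S \<Longrightarrow> pres_eq S R u u"
| sym: "pres_eq S R u v \<Longrightarrow> pres_eq S R v u"
| trans: "pres_eq S R u v \<Longrightarrow> pres_eq S R v w \<Longrightarrow> pres_eq S R u w"
| cancel: "u \<in> words S \<Longrightarrow> v \<in> words S \<Longrightarrow> s \<in> S \<Longrightarrow>
    pres_eq S R (u @ [(s, b), (s, \<not> b)] @ v) (u @ v)"
| relator: "u \<in> words S \<Longrightarrow> v \<in> words S \<Longrightarrow> r \<in> R \<Longrightarrow> r \<in> words S \<Longrightarrow>
    pres_eq S R (u @ r @ v) (u @ v)"

definition pres_rel :: "'a set \<Rightarrow> 'a gword set \<Rightarrow> ('a gword \<times> 'a gword) set" where
  "pres_rel S R = {(u, v). pres_eq S R u v}"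

definition word_class :: "'a set \<Rightarrow> 'a gword set \<Rightarrow> 'a gword \<Rightarrow> 'a gword set" where
  "word_class S R u = pres_rel S R `` {u}"

definition presented_group :: "'a set \<Rightarrow> 'a gword set \<Rightarrow> 'a gword set monoid" where
  "presented_group S R =
    \<lparr> carrier = words S // pres_rel S R,
      monoid.mult = (\<lambda>A B. \<Union>u\<in>A. \<Union>v\<in>B. word_class S R (u @ v)),
      one = word_class S R [] \<rparr>"

lemma append_in_words: "u \<in> words S \<Longrightarrow> v \<in> words S \<Longrightarrow> u @ v \<in> words S"
  by (simp add: words_def)

lemma pres_eq_words: "pres_eq S R u v \<Longrightarrow> u \<in> words S \<and> v \<in> words S"
  by (induction rule: pres_eq.induct) (auto simp: words_def)

lemma equiv_pres_rel: "equiv (words S) (pres_rel S R)"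
proof (rule equivI)
  show "pres_rel S R \<subseteq> words S \<times> words S"
    using pres_eq_words by (force simp: pres_rel_def)
  show "refl_on (words S) (pres_rel S R)"
    by (auto simp: refl_on_def pres_rel_def intro: pres_eq.refl)
  show "Relation.sym (pres_rel S R)"
    by (auto simp: sym_def pres_rel_def intro: pres_eq.sym)
  show "Relation.trans (pres_rel S R)"
    by (auto simp: trans_def pres_rel_def intro: pres_eq.trans)
qed

lemma pres_eq_append_left:
  assumes "pres_eq S R u v" "w \<in> words S"
  shows "pres_eq S R (w @ u) (w @ v)"
  using assms
proof (induction rule: pres_eq.induct)
  case (cancel u v s b)
  then show ?case
    using pres_eq.cancel[of "w @ u" S v s R b] by (simp add: append_in_words)
next
  case (relator u v r)
  then show ?case
    using pres_eq.relator[of "w @ u" S v r R] by (simp add: append_in_words)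
qed (auto intro: pres_eq.refl pres_eq.sym pres_eq.trans append_in_words)

lemma pres_eq_append_right:
  assumes "pres_eq S R u v" "w \<in> words S"
  shows "pres_eq S R (u @ w) (v @ w)"
  using assms
proof (induction rule: pres_eq.induct)
  case (cancel u v s b)
  then show ?case
    using pres_eq.cancel[of u S "v @ w" s R b] by (simp add: append_in_words)
next
  case (relator u v r)
  then show ?case
    using pres_eq.relator[of u S "v @ w" r R] by (simp add: append_in_words)
qed (auto intro: pres_eq.refl pres_eq.sym pres_eq.trans append_in_words)

lemma word_class_in_carrier: "u \<in> words S \<Longrightarrow> word_class S R u \<in> carrier (presented_group S R)"
  by (simp add: presented_group_def word_class_def quotientI)

lemma carrier_presented_groupE:
  assumes "A \<in> carrier (presented_group S R)"
  obtains u where "u \<in> words S" "A = word_class S R u"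
  using assms by (auto simp: presented_group_def word_class_def elim: quotientE)

lemma word_class_eq_iff:
  assumes "u \<in> words S" "v \<in> words S"
  shows "word_class S R u = word_class S R v \<longleftrightarrow> pres_eq S R u v"
  using eq_equiv_class_iff[OF equiv_pres_rel assms, of R] by (simp add: word_class_def pres_rel_def)

lemma mult_word_class:
  assumes "u \<in> words S" "v \<in> words S"
  shows "word_class S R u \<otimes>\<^bsub>presented_group S R\<^esub> word_class S R v = word_class S R (u @ v)"
proof -
  have eq: "word_class S R (u' @ v') = word_class S R (u @ v)"
    if "u' \<in> word_class S R u" "v' \<in> word_class S R v" for u' v'
  proof -
    have 1: "pres_eq S R u u'" "pres_eq S R v v'"
      using that by (simp_all add: word_class_def pres_rel_def)
    then have "pres_eq S R (u @ v) (u' @ v')"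
      using assms pres_eq_words
      by (meson pres_eq.trans pres_eq_append_left pres_eq_append_right)
    then show ?thesis
      using pres_eq_words pres_eq.sym word_class_eq_iff by metis
  qed
  have "u \<in> word_class S R u" "v \<in> word_class S R v"
    using assms by (simp_all add: word_class_def pres_rel_def pres_eq.refl)
  then have "(\<Union>u'\<in>word_class S R u. \<Union>v'\<in>word_class S R v. word_class S R (u' @ v'))
      = word_class S R (u @ v)"
    using eq by blast
  then show ?thesis
    by (simp add: presented_group_def)
qed

lemma one_presented_group: "\<one>\<^bsub>presented_group S R\<^esub> = word_class S R []"
  by (simp add: presented_group_def)

lemma ex_left_inverse:
  assumes "u \<in> words S"
  shows "\<exists>u'\<in>words S. pres_eq S R (u' @ u) []"
  using assms
proof (induction u)
  case Nil
  then show ?case by (auto simp: words_def intro!: bexI[of _ "[]"] pres_eq.refl)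
next
  case (Cons x u)
  obtain s b where x: "x = (s, b)" by (cases x)
  have s: "s \<in> S" and u: "u \<in> words S"
    using Cons.prems x by (auto simp: words_def)
  obtain u' where u': "u' \<in> words S" "pres_eq S R (u' @ u) []"
    using Cons.IH u by blast
  have "pres_eq S R (u' @ [(s, \<not> b), (s, \<not> \<not> b)] @ u) (u' @ u)"
    using pres_eq.cancel u'(1) u s .
  then have "pres_eq S R ((u' @ [(s, \<not> b)]) @ x # u) []"
    using u'(2) pres_eq.trans x by fastforce
  moreover have "u' @ [(s, \<not> b)] \<in> words S"
    using u'(1) s by (simp add: words_def)
  ultimately show ?case by blast
qed

lemma group_presented_group: "group (presented_group S R)"
proof (rule groupI)
  have nil: "[] \<in> words S" by (simp add: words_def)
  show "\<one>\<^bsub>presented_group S R\<^esub> \<in> carrier (presented_group S R)"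
    by (simp add: one_presented_group word_class_in_carrier nil)
  show "x \<otimes>\<^bsub>presented_group S R\<^esub> y \<in> carrier (presented_group S R)"
    if "x \<in> carrier (presented_group S R)" "y \<in> carrier (presented_group S R)" for x y
    using that
    by (metis append_in_words carrier_presented_groupE mult_word_class word_class_in_carrier)
  show "x \<otimes>\<^bsub>presented_group S R\<^esub> y \<otimes>\<^bsub>presented_group S R\<^esub> z =
      x \<otimes>\<^bsub>presented_group S R\<^esub> (y \<otimes>\<^bsub>presented_group S R\<^esub> z)"
    if "x \<in> carrier (presented_group S R)" "y \<in> carrier (presented_group S R)"
      "z \<in> carrier (presented_group S R)" for x y z
    using that by (elim carrier_presented_groupE) (simp add: mult_word_class append_in_words)
  show "\<one>\<^bsub>presented_group S R\<^esub> \<otimes>\<^bsub>presented_group S R\<^esub> x = x"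
    if "x \<in> carrier (presented_group S R)" for x
    using that by (elim carrier_presented_groupE) (simp add: mult_word_class one_presented_group nil)
  show "\<exists>y\<in>carrier (presented_group S R). y \<otimes>\<^bsub>presented_group S R\<^esub> x = \<one>\<^bsub>presented_group S R\<^esub>"
    if x: "x \<in> carrier (presented_group S R)" for x
  proof -
    obtain u where u: "u \<in> words S" "x = word_class S R u"
      using x by (rule carrier_presented_groupE)
    obtain u' where u': "u' \<in> words S" "pres_eq S R (u' @ u) []"
      using ex_left_inverse[OF u(1)] by blast
    then have "word_class S R u' \<otimes>\<^bsub>presented_group S R\<^esub> x = \<one>\<^bsub>presented_group S R\<^esub>"
      using u u' nil by (simp add: mult_word_class one_presented_group word_class_eq_iff append_in_words)
    then show ?thesis
      using u'(1) word_class_in_carrier by blast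
  qed
qed

text \<open>
  Graphs are undirected and simple, given by their set of edges, each edge being a two-element
  set of vertices. In particular a generator of order two contributes a single edge
  at every vertex rather than a pair of parallel edges.
\<close>

definition cayley_edges :: "('g, 'b) monoid_scheme \<Rightarrow> 'g set \<Rightarrow> 'g set set" where
  "cayley_edges G A = {{g, g \<otimes>\<^bsub>G\<^esub> a} | g a. g \<in> carrier G \<and> a \<in> A \<and> a \<noteq> \<one>\<^bsub>G\<^esub>}"

definition cayley_graph :: "'a set \<Rightarrow> 'a gword set \<Rightarrow> 'a gword set set set" where
  "cayley_graph S R =
     cayley_edges (presented_group S R) ((\<lambda>s. word_class S R [(s, True)]) ` S)"

fun word_walk :: "'a set \<Rightarrow> 'a gword set \<Rightarrow> 'a gword set \<Rightarrow> 'a gword \<Rightarrow> 'a gword set list" where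
  "word_walk S R g [] = [g]"
| "word_walk S R g (x # w) =
     g # word_walk S R (g \<otimes>\<^bsub>presented_group S R\<^esub> word_class S R [x]) w"

definition vertex_degree :: "'v set set \<Rightarrow> 'v \<Rightarrow> nat" where
  "vertex_degree E v = card {e \<in> E. v \<in> e}"

text \<open>
  A cycle is written as a closed walk \<open>[v\<^sub>0, \<dots>, v\<^sub>n = v\<^sub>0]\<close>, so its length \<open>n\<close> is one less than the
  length of the list.
\<close>

definition is_cycle :: "'v set set \<Rightarrow> 'v list \<Rightarrow> bool" where
  "is_cycle E p \<longleftrightarrow> length p \<ge> 4 \<and> hd p = last p \<and> distinct (tl p) \<and>
     (\<forall>i. Suc i < length p \<longrightarrow> {p ! i, p ! Suc i} \<in> E)"

text \<open>
  The closed walk of a relator \<open>x\<^sup>2\<close> is a two-cycle of the Cayley graph only if the two parallel edges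
  of a generator of order two are kept apart. As they are identified here, such relators
  are admitted separately; they do not influence \<open>longest_relator_cycle\<close>.
\<close>

definition relators_induce_cycles :: "'a set \<Rightarrow> 'a gword set \<Rightarrow> bool" where
  "relators_induce_cycles S R \<longleftrightarrow>
     (\<forall>r\<in>R. (\<exists>x. r = [x, x]) \<or>
        (\<forall>g\<in>carrier (presented_group S R). is_cycle (cayley_graph S R) (word_walk S R g r)))"

definition longest_relator_cycle :: "'a set \<Rightarrow> 'a gword set \<Rightarrow> nat" where
  "longest_relator_cycle S R =
     Max {length p - 1 | p. is_cycle (cayley_graph S R) p \<and>
       (\<exists>r\<in>R. \<exists>g\<in>carrier (presented_group S R). p = word_walk S R g r)}"

definition gamma_pres :: "'a set \<Rightarrow> 'a gword set \<Rightarrow> real" where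
  "gamma_pres S R =
     (let d = vertex_degree (cayley_graph S R) \<one>\<^bsub>presented_group S R\<^esub>;
          m = longest_relator_cycle S R div 2
      in ((2 * real d - 2) ^ m - 1) * exp 1)"


section \<open>Ends\<close>

definition rays :: "'v set set \<Rightarrow> (nat \<Rightarrow> 'v) set" where
  "rays E = {f. inj f \<and> (\<forall>n. {f n, f (Suc n)} \<in> E)}"

definition same_component_avoiding :: "'v set set \<Rightarrow> 'v set \<Rightarrow> 'v \<Rightarrow> 'v \<Rightarrow> bool" where
  "same_component_avoiding E X u v \<longleftrightarrow>
     u \<notin> X \<and> v \<notin> X \<and> (u, v) \<in> {(x, y). {x, y} \<in> E \<and> x \<notin> X \<and> y \<notin> X}\<^sup>*"

text \<open>Two rays are equivalent if, for every finite vertex set, they have tails in the same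
  component of its complement; ends are the equivalence classes.\<close>

definition ray_rel :: "'v set set \<Rightarrow> ((nat \<Rightarrow> 'v) \<times> (nat \<Rightarrow> 'v)) set" where
  "ray_rel E = {(f, g). f \<in> rays E \<and> g \<in> rays E \<and>
     (\<forall>X. finite X \<longrightarrow> (\<exists>N. \<forall>i\<ge>N. \<forall>j\<ge>N. same_component_avoiding E X (f i) (g j)))}"

definition ends :: "'v set set \<Rightarrow> (nat \<Rightarrow> 'v) set set" where
  "ends E = rays E // ray_rel E"

definition one_ended :: "'v set set \<Rightarrow> bool" where
  "one_ended E \<longleftrightarrow> card (ends E) = 1"


section \<open>Bernoulli bond percolation\<close>

definition percolation :: "'v set set \<Rightarrow> real \<Rightarrow> ('v set \<Rightarrow> bool) measure" where
  "percolation E p = (\<Pi>\<^sub>M e\<in>E. measure_pmf (bernoulli_pmf p))"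

definition cluster :: "'v set set \<Rightarrow> ('v set \<Rightarrow> bool) \<Rightarrow> 'v \<Rightarrow> 'v set" where
  "cluster E \<omega> v = {w. (v, w) \<in> {(x, y). {x, y} \<in> E \<and> \<omega> {x, y}}\<^sup>*}"

definition theta :: "'v set set \<Rightarrow> 'v \<Rightarrow> real \<Rightarrow> real" where
  "theta E v p =
     measure (percolation E p) {\<omega> \<in> space (percolation E p). infinite (cluster E \<omega> v)}"

definition real_analytic_on :: "(real \<Rightarrow> real) \<Rightarrow> real set \<Rightarrow> bool" where
  "real_analytic_on f I \<longleftrightarrow>
     (\<forall>x\<in>I. \<exists>r>0. \<exists>g. g holomorphic_on ball (complex_of_real x) r \<and>
        (\<forall>y\<in>I. complex_of_real y \<in> ball (complex_of_real x) r \<longrightarrow>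
           g (complex_of_real y) = complex_of_real (f y)))"

definition p_analytic :: "'v set set \<Rightarrow> 'v \<Rightarrow> real" where
  "p_analytic E v = Inf {p. 0 \<le> p \<and> p \<le> 1 \<and> real_analytic_on (theta E v) {p<..1}}"

end

theory Submission
  imports Defs
begin

text \<open>
  Call two edges of \<open>G\<close> close if their distance in the line graph is at most \<open>m = \<lfloor>t / 2\<rfloor>\<close>; every edge is
  close to at most \<open>\<Delta> = (2d - 2)^m\<close> others. If the cluster of \<open>o\<close> is finite then, \<open>G\<close> being 1-ended, the edges
  between it and the infinite component of its complement form a vacant cut with connected sides.
  Since relator cycles generate all closed walks, no partition of this cut avoids being crossed by a
  relator cycle, so the cut lies in one cluster of the vacant edges with respect to closeness. Thus
  \<open>C(o)\<close> is finite iff some such vacant cluster separates \<open>o\<close> from infinity. A separating cluster meets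
  a fixed geodesic ray from \<open>o\<close>, and if it contains the \<open>i\<close>-th edge of the ray its size is at least linear in \<open>i\<close>.

  Let \<open>i\<close> be the first edge of the ray whose vacant cluster separates, and \<open>U\<close> the union of the vacant
  clusters of the edges up to \<open>i\<close>. The pair \<open>(i, U)\<close> depends on \<open>O(|U| + i)\<close> edges only, so
  \<open>1 - \<theta>(p)\<close> is the sum of the polynomials \<open>(1 - p)^|U| p^b\<close> over all such pairs, where \<open>b = O(|U| + i)\<close> is the size of
  the boundary. As connected sets of \<open>n\<close> edges containing a given edge number \<open>O(((\<Delta> - 1) e)^n)\<close>, the series still
  converges when every factor is enlarged slightly, and Weierstrass' test applies on complex discs.
\<close>

section \<open>Clusters of vacant edges\<close>

text \<open>The half of \<open>t\<close> comes from the shorter arc between two edges of a relator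
  cycle. The factor \<open>(\<Delta> - 1) e\<close> comes from a probabilistic count: a connected
  set of \<open>n\<close> edges has at most \<open>(\<Delta> - 2) n + 2\<close> boundary edges, so
  disjoint cluster events weigh it by at least a constant times
  \<open>(q (1 - q) ^ (\<Delta> - 2)) ^ n\<close>, and a suitable \<open>q\<close> makes the base at
  least \<open>1 / ((\<Delta> - 1) e)\<close>. The obstacle is convergence for complex parameters. A
  separating cluster at the \<open>i\<close>-th edge is only known to have size at least a small
  multiple of \<open>i\<close>, whereas \<open>U\<close> unites up to \<open>i + 1\<close> clusters
  and counting costs a constant factor for each, which that decay need not beat. Counting is
  therefore reserved for large \<open>U\<close>; for small \<open>U\<close> the terms at a real
  parameter are probabilities of disjoint events inside one rare event. Complex terms are compared
  with real ones at the leftmost point \<open>p\<close> of the disc: there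
  \<open>|z| \<le> p (1 + \<epsilon>)\<close> and
  \<open>|1 - z| \<le> (1 - p) (1 + \<epsilon>)\<close>, so leaving the real line costs only a
  factor close to 1 per edge examined.\<close>

definition reach :: "('e \<times> 'e) set \<Rightarrow> 'e set \<Rightarrow> 'e set \<Rightarrow> 'e set" where
  "reach H A W = (H \<inter> W \<times> W)\<^sup>* `` (A \<inter> W)"

text \<open>Elements of \<open>A\<close> outside \<open>U\<close> belong to the boundary too: for
  the exploration from \<open>A\<close> to return exactly \<open>U\<close>, these starting edges
  must be occupied.\<close>

definition bd :: "('e \<times> 'e) set \<Rightarrow> 'e set \<Rightarrow> 'e set \<Rightarrow> 'e set" where
  "bd H A U = (A \<union> H `` U) - U"

lemma reach_least:
  assumes "A \<inter> W \<subseteq> X" "\<And>x y. x \<in> X \<Longrightarrow> x \<in> W \<Longrightarrow> y \<in> W \<Longrightarrow> (x, y) \<in> H \<Longrightarrow> y \<in> X"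
  shows "reach H A W \<subseteq> X"
proof
  fix y assume "y \<in> reach H A W"
  then obtain a where a: "a \<in> A" "a \<in> W" "(a, y) \<in> (H \<inter> W \<times> W)\<^sup>*"
    by (auto simp: reach_def)
  from a(3) show "y \<in> X"
    by induction (use a assms in auto)
qed

lemma reach_base: "A \<inter> W \<subseteq> reach H A W"
  by (auto simp: reach_def)

lemma reach_subset: "reach H A W \<subseteq> W"
  by (rule reach_least) auto

lemma reach_step: "x \<in> reach H A W \<Longrightarrow> (x, y) \<in> H \<Longrightarrow> y \<in> W \<Longrightarrow> y \<in> reach H A W"
proof -
  assume "x \<in> reach H A W" and xy: "(x, y) \<in> H" "y \<in> W"
  then obtain a where a: "a \<in> A" "a \<in> W" "(a, x) \<in> (H \<inter> W \<times> W)\<^sup>*"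
    by (auto simp: reach_def)
  moreover have "x \<in> W"
    using \<open>x \<in> reach H A W\<close> by (rule subsetD[OF reach_subset])
  ultimately have "(a, y) \<in> (H \<inter> W \<times> W)\<^sup>*"
    using xy by (simp add: rtrancl.rtrancl_into_rtrancl)
  then show "y \<in> reach H A W"
    using a by (auto simp: reach_def)
qed

lemma reach_mono: "A \<subseteq> B \<Longrightarrow> reach H A W \<subseteq> reach H B W"
  by (auto simp: reach_def)

lemma reach_mono_set: "W \<subseteq> W' \<Longrightarrow> reach H A W \<subseteq> reach H A W'"
  by (rule reach_least) (use reach_base[of A W' H] in \<open>auto intro: reach_step\<close>)

text \<open>Paths starting in \<open>B\<close> stay inside the clusters of \<open>A\<close>, so the
  clusters of earlier ray edges can be read off from the explored union alone.\<close>

lemma reach_restrict: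
  assumes "B \<subseteq> A"
  shows "reach H B (reach H A W) = reach H B W"
proof
  show "reach H B (reach H A W) \<subseteq> reach H B W"
    by (rule reach_mono_set[OF reach_subset])
  show "reach H B W \<subseteq> reach H B (reach H A W)"
  proof (rule reach_least)
    have "A \<inter> W \<subseteq> reach H A W" by (rule reach_base)
    then have "B \<inter> W \<subseteq> B \<inter> reach H A W" using assms by auto
    also have "\<dots> \<subseteq> reach H B (reach H A W)" by (rule reach_base)
    finally show "B \<inter> W \<subseteq> reach H B (reach H A W)" .
    fix x y assume *: "x \<in> reach H B (reach H A W)" "y \<in> W" "(x, y) \<in> H"
    have "x \<in> reach H A W" using *(1) by (rule subsetD[OF reach_subset])
    then have "y \<in> reach H A W" using *(3,2) by (rule reach_step)
    with *(1,3) show "y \<in> reach H B (reach H A W)" by (rule reach_step)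
  qed
qed

lemma reach_idem: "reach H A (reach H A W) = reach H A W"
  by (simp add: reach_restrict)

text \<open>Exploration is local: the first step out of \<open>U\<close> would land in
  \<open>bd H A U\<close>. This turns the event that the exploration returns \<open>U\<close> into a
  cylinder event, whose probability is a polynomial.\<close>

lemma reach_eq_iff:
  "reach H A W = U \<longleftrightarrow> U \<subseteq> W \<and> reach H A U = U \<and> bd H A U \<inter> W = {}"
proof
  assume U: "reach H A W = U"
  then have "bd H A U \<inter> W = {}"
    using reach_base[of A W H] reach_step[of _ H A W] by (auto simp: bd_def)
  then show "U \<subseteq> W \<and> reach H A U = U \<and> bd H A U \<inter> W = {}"
    using U reach_idem reach_subset by metis
next
  assume U: "U \<subseteq> W \<and> reach H A U = U \<and> bd H A U \<inter> W = {}"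
  have "reach H A W \<subseteq> U"
    by (rule reach_least) (use U in \<open>auto simp: bd_def\<close>)
  then show "reach H A W = U"
    using U reach_mono_set[of U W H A] by auto
qed

lemma reach_sing_ne: "reach H {a} U = U \<Longrightarrow> U \<noteq> {} \<longleftrightarrow> a \<in> U"
  using reach_least[of "{a}" U "{}" H] by auto

text \<open>No step inside \<open>U\<close> leaves the component \<open>K\<close>, so a path ending
  outside \<open>K\<close> avoids it throughout and starts in \<open>A\<close>. This peels off one
  component at a time in \<open>sum_valid_le\<close>.\<close>

lemma reach_Diff:
  assumes "sym H" and U: "reach H (insert a A) U = U"
  defines "K \<equiv> reach H {a} U"
  shows "reach H A (U - K) = U - K"
proof
  show "reach H A (U - K) \<subseteq> U - K" by (rule reach_subset)
  have "U \<subseteq> K \<union> reach H A (U - K)"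
  proof -
    have "reach H (insert a A) U \<subseteq> K \<union> reach H A (U - K)"
    proof (rule reach_least)
      show "insert a A \<inter> U \<subseteq> K \<union> reach H A (U - K)"
        using reach_base[of "{a}" U H] reach_base[of A "U - K" H] by (auto simp: K_def)
      fix x y assume *: "x \<in> K \<union> reach H A (U - K)" "x \<in> U" "y \<in> U" "(x, y) \<in> H"
      show "y \<in> K \<union> reach H A (U - K)"
      proof (cases "y \<in> K")
        case False
        then have "x \<notin> K" using * by (auto simp: K_def intro: reach_step)
        then show ?thesis using * False by (auto intro: reach_step)
      qed auto
    qed
    then show ?thesis using U by simp
  qed
  then show "U - K \<subseteq> reach H A (U - K)" by auto
qed

section \<open>Percolation explored along a relation of bounded degree\<close>

locale bounded_relation =
  fixes E :: "'v set set" and H :: "('v set \<times> 'v set) set" and \<Delta> :: nat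
  assumes countable_E: "countable E"
    and H_sub: "H \<subseteq> E \<times> E"
    and sym_H: "sym H"
    and finite_nbrs: "\<And>e. e \<in> E \<Longrightarrow> finite (H `` {e})"
    and card_nbrs: "\<And>e. e \<in> E \<Longrightarrow> card (H `` {e}) \<le> \<Delta>"
    and \<Delta>_ge_2: "2 \<le> \<Delta>"
begin

definition vac :: "('v set \<Rightarrow> bool) \<Rightarrow> 'v set set" where
  "vac \<omega> = {e \<in> E. \<not> \<omega> e}"

text \<open>The parameter 0 is a placeholder: the sample space is the same for every
  \<open>p\<close>.\<close>

definition cyl :: "'v set set \<Rightarrow> 'v set set \<Rightarrow> ('v set \<Rightarrow> bool) set" where
  "cyl U B = {\<omega> \<in> space (percolation E 0). (\<forall>e\<in>U. \<not> \<omega> e) \<and> (\<forall>e\<in>B. \<omega> e)}"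

lemma space_percolation: "space (percolation E p) = (\<Pi>\<^sub>E e\<in>E. UNIV)"
  by (simp add: percolation_def space_PiM)

lemma prob_space_percolation: "prob_space (percolation E p)"
  unfolding percolation_def by (intro prob_space_PiM prob_space_measure_pmf)

lemma measurable_edge [measurable]:
  "e \<in> E \<Longrightarrow> (\<lambda>\<omega>. \<omega> e) \<in> measurable (percolation E p) (count_space UNIV)"
  unfolding percolation_def
  using measurable_component_singleton[of e E "\<lambda>_. measure_pmf (bernoulli_pmf p)"]
  by (simp cong: measurable_cong_sets)

lemma cyl_event:
  assumes "U \<subseteq> E" "B \<subseteq> E" "finite U" "finite B"
  shows "cyl U B \<in> sets (percolation E p)"
proof -
  have "{\<omega> \<in> space (percolation E p). (\<forall>e\<in>U. \<not> \<omega> e) \<and> (\<forall>e\<in>B. \<omega> e)} \<in> sets (percolation E p)"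
    by (intro sets.sets_Collect_conj sets.sets_Collect_finite_All sets.sets_Collect_neg
        predE measurable_edge) (use assms in auto)
  then show ?thesis by (simp add: cyl_def space_percolation)
qed

lemma measure_cyl:
  assumes "U \<subseteq> E" "B \<subseteq> E" "finite U" "finite B" "U \<inter> B = {}" "0 \<le> p" "p \<le> 1"
  shows "measure (percolation E p) (cyl U B) = (1 - p) ^ card U * p ^ card B"
proof -
  interpret product_prob_space "\<lambda>_. measure_pmf (bernoulli_pmf p)" E
    by (intro product_prob_spaceI prob_space_measure_pmf)
  let ?X = "\<lambda>e. if e \<in> U then {False} else {True}"
  have "cyl U B = {\<omega> \<in> space (Pi\<^sub>M E (\<lambda>_. measure_pmf (bernoulli_pmf p))). \<forall>e\<in>U \<union> B. \<omega> e \<in> ?X e}"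
    using assms(5) by (auto simp: cyl_def space_percolation space_PiM)
  then have "emeasure (percolation E p) (cyl U B) = (\<Prod>e\<in>U \<union> B. emeasure (measure_pmf (bernoulli_pmf p)) (?X e))"
    unfolding percolation_def using assms by (simp add: emeasure_PiM_Collect)
  also have "\<dots> = (\<Prod>e\<in>U. emeasure (measure_pmf (bernoulli_pmf p)) {False}) * (\<Prod>e\<in>B. emeasure (measure_pmf (bernoulli_pmf p)) {True})"
  proof -
    have "e \<notin> U" if "e \<in> B" for e using assms(5) that by auto
    then show ?thesis
      using assms by (subst prod.union_disjoint) (auto intro!: arg_cong2[of _ _ _ _ "(*)"] prod.cong)
  qed
  also have "\<dots> = ennreal ((1 - p) ^ card U * p ^ card B)"
    using assms by (simp add: emeasure_pmf_single ennreal_mult ennreal_power)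
  finally show ?thesis
    using assms by (simp add: measure_def)
qed

definition conn :: "'v set \<Rightarrow> 'v set set set" where
  "conn e = {K. K \<subseteq> E \<and> finite K \<and> e \<in> K \<and> reach H {e} K = K}"

text \<open>The finite outcomes of an exploration from \<open>A\<close>. Occupied starting edges
  contribute nothing, so \<open>A\<close> need not lie in \<open>U\<close> and \<open>{}\<close> is
  an outcome.\<close>

definition valid :: "'v set set \<Rightarrow> 'v set set set" where
  "valid A = {U. U \<subseteq> E \<and> finite U \<and> reach H A U = U}"

lemma conn_eq: "conn e = {K \<in> valid {e}. K \<noteq> {}}"
  using reach_sing_ne[of H e] by (auto simp: conn_def valid_def)

lemma finite_bd: "finite U \<Longrightarrow> U \<subseteq> E \<Longrightarrow> finite A \<Longrightarrow> finite (bd H A U)"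
proof -
  assume U: "finite U" "U \<subseteq> E" and "finite A"
  have "H `` U = (\<Union>e\<in>U. H `` {e})" by auto
  also have "finite \<dots>" using U finite_nbrs by auto
  finally show ?thesis using \<open>finite A\<close> by (simp add: bd_def)
qed

lemma card_bd: "finite U \<Longrightarrow> U \<subseteq> E \<Longrightarrow> finite A \<Longrightarrow> card (bd H A U) \<le> card A + \<Delta> * card U"
proof -
  assume U: "finite U" "U \<subseteq> E" and A: "finite A"
  have eq: "H `` U = (\<Union>e\<in>U. H `` {e})" by auto
  have fin: "finite (H `` U)" unfolding eq using U finite_nbrs by auto
  have "card (H `` U) \<le> (\<Sum>e\<in>U. card (H `` {e}))" unfolding eq by (rule card_UN_le[OF U(1)])
  also have "\<dots> \<le> (\<Sum>e\<in>U. \<Delta>)" using U card_nbrs by (intro sum_mono) auto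
  also have "\<dots> = \<Delta> * card U" by simp
  finally have 1: "card (H `` U) \<le> \<Delta> * card U" .
  have "card (bd H A U) \<le> card (A \<union> H `` U)"
    unfolding bd_def using A fin by (intro card_mono) auto
  also have "\<dots> \<le> card A + card (H `` U)" by (rule card_Un_le)
  finally show ?thesis using 1 by simp
qed

lemma bd_sub: "A \<subseteq> E \<Longrightarrow> bd H A U \<subseteq> E"
  using H_sub by (auto simp: bd_def)

lemma reach_event_eq_cyl:
  assumes "U \<in> valid A" "A \<subseteq> E"
  shows "{\<omega> \<in> space (percolation E p). reach H A (vac \<omega>) = U} = cyl U (bd H A U)"
proof -
  have U: "U \<subseteq> E" "reach H A U = U" using assms by (auto simp: valid_def)
  have "bd H A U \<subseteq> E" using assms(2) by (rule bd_sub)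
  then have "reach H A (vac \<omega>) = U \<longleftrightarrow> (\<forall>e\<in>U. \<not> \<omega> e) \<and> (\<forall>e\<in>bd H A U. \<omega> e)" for \<omega>
    using U by (subst reach_eq_iff) (auto simp: vac_def)
  then show ?thesis
    unfolding cyl_def space_percolation by simp
qed

lemma reach_event:
  assumes "U \<in> valid A" "A \<subseteq> E" "finite A"
  shows "{\<omega> \<in> space (percolation E p). reach H A (vac \<omega>) = U} \<in> sets (percolation E p)"
  unfolding reach_event_eq_cyl[OF assms(1,2)]
  using assms by (intro cyl_event bd_sub finite_bd) (auto simp: valid_def)

lemma measure_reach_event:
  assumes "U \<in> valid A" "A \<subseteq> E" "finite A" "0 \<le> p" "p \<le> 1"
  shows "measure (percolation E p) {\<omega> \<in> space (percolation E p). reach H A (vac \<omega>) = U}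
    = (1 - p) ^ card U * p ^ card (bd H A U)"
  unfolding reach_event_eq_cyl[OF assms(1,2)]
  using assms by (intro measure_cyl bd_sub finite_bd) (auto simp: valid_def bd_def)

text \<open>Different outcomes are disjoint events. Sums of weights are thus probabilities, which is
  the source of every bound on them that does not count sets.\<close>

lemma sum_reach_events:
  assumes "F \<subseteq> valid A" "finite F" "A \<subseteq> E" "finite A" "0 \<le> p" "p \<le> 1"
  shows "(\<Sum>U\<in>F. (1 - p) ^ card U * p ^ card (bd H A U)) =
    measure (percolation E p) {\<omega> \<in> space (percolation E p). reach H A (vac \<omega>) \<in> F}"
proof -
  interpret prob_space "percolation E p" by (rule prob_space_percolation)
  let ?ev = "\<lambda>U. {\<omega> \<in> space (percolation E p). reach H A (vac \<omega>) = U}"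
  have "{\<omega> \<in> space (percolation E p). reach H A (vac \<omega>) \<in> F} = (\<Union>U\<in>F. ?ev U)"
    by auto
  also have "prob \<dots> = (\<Sum>U\<in>F. prob (?ev U))"
    using assms by (intro finite_measure_finite_Union) (auto intro!: reach_event simp: disjoint_family_on_def)
  also have "\<dots> = (\<Sum>U\<in>F. (1 - p) ^ card U * p ^ card (bd H A U))"
    using assms by (intro sum.cong HOL.refl measure_reach_event) auto
  finally show ?thesis by simp
qed

lemma exists_conn_subset:
  assumes K: "K \<subseteq> E" "e \<in> K" "reach H {e} K = K" and n: "infinite K \<or> n < card K"
  shows "\<exists>K'\<in>conn e. K' \<subseteq> K \<and> card K' = Suc n \<and> card (bd H {e} K') + 2 * Suc n \<le> \<Delta> * Suc n + 2"
  using n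
proof (induction n)
  case 0
  have "card (bd H {e} {e}) \<le> card (H `` {e})"
    using K finite_nbrs by (intro card_mono) (auto simp: bd_def)
  also have "\<dots> \<le> \<Delta>" using K by (intro card_nbrs) auto
  finally have "card (bd H {e} {e}) \<le> \<Delta>" .
  moreover have "reach H {e} {e} = {e}"
    using reach_base[of "{e}" "{e}" H] reach_subset[of H "{e}" "{e}"] by auto
  ultimately show ?case
    using K by (intro bexI[of _ "{e}"]) (auto simp: conn_def)
next
  case (Suc n)
  then obtain K' where K': "K' \<in> conn e" "K' \<subseteq> K" "card K' = Suc n"
    "card (bd H {e} K') + 2 * Suc n \<le> \<Delta> * Suc n + 2"
    by auto
  \<comment> \<open>Otherwise \<open>K'\<close> would be closed under steps inside \<open>K\<close>
    and hence be all of \<open>K\<close>.\<close>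
  have "\<exists>x y. x \<in> K' \<and> y \<in> K - K' \<and> (x, y) \<in> H"
  proof (rule ccontr)
    assume neg: "\<not> ?thesis"
    have "reach H {e} K \<subseteq> K'"
      by (rule reach_least) (use neg K' in \<open>auto simp: conn_def\<close>)
    then have "K = K'" using K K' by simp
    then show False using Suc.prems K' by (auto simp: conn_def)
  qed
  then obtain x y where xy: "x \<in> K'" "y \<in> K" "y \<notin> K'" "(x, y) \<in> H" by auto
  have yx: "(y, x) \<in> H" using xy sym_H by (auto dest: symD)
  have K'_props: "K' \<subseteq> E" "finite K'" "e \<in> K'" "reach H {e} K' = K'"
    using K' by (auto simp: conn_def)
  let ?K = "insert y K'"
  have sub: "K' \<subseteq> reach H {e} ?K"
    using reach_mono_set[of K' ?K H "{e}"] K'_props by auto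
  then have "y \<in> reach H {e} ?K"
    using reach_step[of x H "{e}" ?K y] xy by auto
  then have "reach H {e} ?K = ?K"
    using sub reach_subset[of H "{e}" ?K] by auto
  then have conn: "?K \<in> conn e"
    using K'_props K xy by (auto simp: conn_def)
  have fin: "finite (bd H {e} K')" using K'_props by (intro finite_bd) auto
  have y: "y \<in> E" using xy K by auto
  have "bd H {e} ?K \<subseteq> (bd H {e} K' - {y}) \<union> (H `` {y} - {x})"
    using xy K'_props by (auto simp: bd_def)
  then have "card (bd H {e} ?K) \<le> card ((bd H {e} K' - {y}) \<union> (H `` {y} - {x}))"
    using fin finite_nbrs[OF y] by (intro card_mono) auto
  also have "\<dots> \<le> card (bd H {e} K' - {y}) + card (H `` {y} - {x})"
    by (rule card_Un_le)
  also have "card (bd H {e} K' - {y}) = card (bd H {e} K') - 1"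
    using fin xy by (intro card_Diff_singleton) (auto simp: bd_def)
  also have "card (H `` {y} - {x}) = card (H `` {y}) - 1"
    using yx by (intro card_Diff_singleton) auto
  also have "card (H `` {y}) - 1 \<le> \<Delta> - 1"
    using card_nbrs[OF y] by auto
  finally have "card (bd H {e} ?K) \<le> card (bd H {e} K') - 1 + (\<Delta> - 1)"
    by simp
  moreover have "card (bd H {e} K') \<ge> 1"
    using fin xy by (auto simp: bd_def Suc_le_eq card_gt_0_iff)
  ultimately have "card (bd H {e} ?K) + 2 * Suc (Suc n) \<le> \<Delta> * Suc (Suc n) + 2"
    using K'(4) \<Delta>_ge_2 by simp
  then show ?case
    using conn K' xy K'_props by (intro bexI[of _ ?K]) auto
qed

text \<open>Growing to the full size \<open>card K\<close> forces the subset found to be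
  \<open>K\<close> itself. Unlike \<open>card_bd\<close>, this bound is sharp enough for the growth
  constant.\<close>

lemma card_bd_conn:
  assumes "K \<in> conn e"
  shows "card (bd H {e} K) \<le> (\<Delta> - 2) * card K + 2"
proof -
  have K: "K \<subseteq> E" "e \<in> K" "reach H {e} K = K" "finite K"
    using assms by (auto simp: conn_def)
  then have "card K > 0" by (auto simp: card_gt_0_iff)
  then obtain K' where "K' \<subseteq> K" "card K' = card K" and
    b: "card (bd H {e} K') + 2 * card K \<le> \<Delta> * card K + 2"
    using exists_conn_subset[OF K(1-3), of "card K - 1"] by auto
  then have "K' = K" using K by (simp add: card_subset_eq)
  then show ?thesis using b \<Delta>_ge_2 by (simp add: diff_mult_distrib)
qed

text \<open>The events that the vacant cluster of \<open>e\<close> equals \<open>K\<close>, for percolation with vacancy probability \<open>q\<close>, are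
  disjoint; hence the total weight below is bounded.\<close>

lemma sum_conn_le:
  assumes F: "F \<subseteq> conn e" "finite F" "e \<in> E" and q: "0 < q" "q < (1::real)"
  shows "(\<Sum>K\<in>F. (q * (1 - q) ^ (\<Delta> - 2)) ^ card K) \<le> 1 / (1 - q) ^ 2"
proof -
  interpret prob_space "percolation E (1 - q)" by (rule prob_space_percolation)
  \<comment> \<open>The factor \<open>(1 - q) ^ 2\<close> pays for the additive 2 in
    \<open>card_bd_conn\<close>.\<close>
  have "(\<Sum>K\<in>F. (q * (1 - q) ^ (\<Delta> - 2)) ^ card K) * (1 - q) ^ 2
      = (\<Sum>K\<in>F. q ^ card K * (1 - q) ^ ((\<Delta> - 2) * card K + 2))"
    unfolding sum_distrib_right power_mult_distrib power_add power_mult by (simp only: mult.assoc)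
  also have "\<dots> \<le> (\<Sum>K\<in>F. (1 - (1 - q)) ^ card K * (1 - q) ^ card (bd H {e} K))"
  proof (intro sum_mono mult_mono)
    fix K assume "K \<in> F"
    then have "K \<in> conn e" using F by auto
    then show "(1 - q) ^ ((\<Delta> - 2) * card K + 2) \<le> (1 - q) ^ card (bd H {e} K)"
      using q by (intro power_decreasing card_bd_conn) auto
  qed (use q in auto)
  also have "\<dots> \<le> 1"
    using F q by (subst sum_reach_events) (auto simp: conn_eq)
  finally show ?thesis
    using q by (simp add: field_simps)
qed

text \<open>The right side is maximal at \<open>q = 1 / (\<Delta> - 1)\<close>, where the claim
  reduces to \<open>(1 + 1/k) ^ k \<le> exp 1\<close> with \<open>k = \<Delta> - 2\<close>. For
  \<open>\<Delta> = 2\<close> that choice would be 1, so \<open>1/2\<close> is taken, and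
  \<open>2 \<le> exp 1\<close> suffices.\<close>

lemma growth_parameter:
  "\<exists>q>0. q < 1 \<and> 1 / ((real \<Delta> - 1) * exp 1) \<le> q * (1 - q) ^ (\<Delta> - 2)"
proof (cases "\<Delta> = 2")
  case True
  have "(2::real) \<le> exp 1" using exp_ge_add_one_self[of 1] by simp
  then show ?thesis
    using True by (intro exI[of _ "1/2"]) (auto simp: field_simps)
next
  case False
  define k where "k = \<Delta> - 2"
  have k: "k \<ge> 1" "real \<Delta> - 1 = real k + 1" using False \<Delta>_ge_2 by (auto simp: k_def)
  have "(1 + 1 / real k) ^ k \<le> exp (1 / real k) ^ k"
    by (intro power_mono) auto
  also have "\<dots> = exp 1" using k by (simp flip: exp_of_nat_mult)
  finally have le: "(1 + 1 / real k) ^ k \<le> exp 1" .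
  have eq: "(1 - 1 / (real k + 1)) = 1 / (1 + 1 / real k)"
    using k by (simp add: field_simps)
  have "1 / exp 1 \<le> 1 / (1 + 1 / real k) ^ k"
  proof (rule divide_left_mono[OF le])
    show "0 < exp 1 * (1 + 1 / real k) ^ k"
      using k by (simp add: add_pos_nonneg)
  qed simp
  also have "\<dots> = (1 - 1 / (real k + 1)) ^ k"
    unfolding eq by (simp only: power_one_over)
  finally have "1 / (real k + 1) * (1 / exp 1) \<le> 1 / (real k + 1) * (1 - 1 / (real k + 1)) ^ k"
    by (intro mult_left_mono) auto
  moreover have "1 / ((real \<Delta> - 1) * exp 1) = 1 / (real k + 1) * (1 / exp 1)"
    unfolding k(2) by simp
  ultimately have *: "1 / ((real \<Delta> - 1) * exp 1) \<le> 1 / (real k + 1) * (1 - 1 / (real k + 1)) ^ (\<Delta> - 2)"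
    by (simp only: k_def)
  show ?thesis
    by (intro exI[of _ "1 / (real k + 1)"] conjI *) (use k in auto)
qed

lemma growth_constant:
  obtains C :: real where "C \<ge> 0"
    "\<And>e F. e \<in> E \<Longrightarrow> F \<subseteq> conn e \<Longrightarrow> finite F \<Longrightarrow>
       (\<Sum>K\<in>F. (1 / ((real \<Delta> - 1) * exp 1)) ^ card K) \<le> C"
proof -
  obtain q where q: "q > 0" "q < 1" "1 / ((real \<Delta> - 1) * exp 1) \<le> q * (1 - q) ^ (\<Delta> - 2)"
    using growth_parameter by auto
  show ?thesis
  proof (rule that[of "1 / (1 - q) ^ 2"])
    fix e F assume F: "e \<in> E" "F \<subseteq> conn e" "finite F"
    have "(\<Sum>K\<in>F. (1 / ((real \<Delta> - 1) * exp 1)) ^ card K) \<le> (\<Sum>K\<in>F. (q * (1 - q) ^ (\<Delta> - 2)) ^ card K)"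
      using q \<Delta>_ge_2 by (intro sum_mono power_mono) auto
    also have "\<dots> \<le> 1 / (1 - q) ^ 2"
      using F q by (intro sum_conn_le) auto
    finally show "(\<Sum>K\<in>F. (1 / ((real \<Delta> - 1) * exp 1)) ^ card K) \<le> 1 / (1 - q) ^ 2" .
  qed auto
qed

text \<open>\<open>U\<close> splits injectively into the component of \<open>a\<close> and the rest,
  which is an outcome for the remaining starting edges. The sum is dominated by a product; the 1 in
  \<open>1 + C\<close> stands for the empty component, when \<open>a\<close> is not in
  \<open>U\<close>.\<close>

lemma sum_valid_le:
  assumes x: "0 \<le> x" and C: "0 \<le> C"
    "\<And>e F. e \<in> E \<Longrightarrow> F \<subseteq> conn e \<Longrightarrow> finite F \<Longrightarrow> (\<Sum>K\<in>F. x ^ card K) \<le> (C::real)"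
    and A: "finite A" "A \<subseteq> E" and F: "F \<subseteq> valid A" "finite F"
  shows "(\<Sum>U\<in>F. x ^ card U) \<le> (1 + C) ^ card A"
  using A F
proof (induction A arbitrary: F)
  case empty
  have "U = {}" if "U \<in> valid {}" for U
    using that reach_least[of "{}" U "{}" H] by (auto simp: valid_def)
  then have "F \<subseteq> {{}}" using empty by auto
  then have "F = {} \<or> F = {{}}" by auto
  then show ?case by auto
next
  case (insert a A)
  define k where "k U = reach H {a} U" for U
  define g where "g U = (k U, U - k U)" for U
  have k_sub: "k U \<subseteq> U" for U unfolding k_def by (rule reach_subset)
  have "inj g"
  proof (rule injI)
    fix U U' assume "g U = g U'"
    then have "k U \<union> (U - k U) = k U' \<union> (U' - k U')" by (auto simp: g_def)
    then show "U = U'" using k_sub by auto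
  qed
  have kF: "k ` F - {{}} \<subseteq> conn a"
  proof -
    have "k U \<in> valid {a}" if "U \<in> F" for U
      using that insert.prems k_sub[of U] reach_idem[of H "{a}" U]
      by (auto simp: valid_def k_def intro: finite_subset)
    then show ?thesis by (auto simp: conn_eq)
  qed
  have dF: "(\<lambda>U. U - k U) ` F \<subseteq> valid A"
    using insert.prems reach_Diff[OF sym_H, of a A] by (auto simp: valid_def k_def)
  have "(\<Sum>U\<in>F. x ^ card U) = (\<Sum>U\<in>F. (\<lambda>(K, L). x ^ card K * x ^ card L) (g U))"
  proof (rule sum.cong[OF HOL.refl])
    fix U assume "U \<in> F"
    then have fin: "finite U" using insert.prems by (auto simp: valid_def)
    have "card U = card (k U) + card (U - k U)"
      using fin k_sub[of U] card_mono[OF fin k_sub[of U]] by (simp add: card_Diff_subset finite_subset)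
    then show "x ^ card U = (\<lambda>(K, L). x ^ card K * x ^ card L) (g U)"
      by (simp add: g_def power_add)
  qed
  also have "\<dots> = (\<Sum>(K, L)\<in>g ` F. x ^ card K * x ^ card L)"
    using \<open>inj g\<close> by (subst sum.reindex) (auto intro: inj_on_subset)
  also have "\<dots> \<le> (\<Sum>(K, L)\<in>(k ` F) \<times> ((\<lambda>U. U - k U) ` F). x ^ card K * x ^ card L)"
    using insert.prems x by (intro sum_mono2) (auto simp: g_def)
  also have "\<dots> = (\<Sum>K\<in>k ` F. x ^ card K) * (\<Sum>L\<in>(\<lambda>U. U - k U) ` F. x ^ card L)"
    by (simp add: sum_product sum.cartesian_product)
  also have "\<dots> \<le> (1 + C) * (1 + C) ^ card A"
  proof (intro mult_mono)
    have "(\<Sum>K\<in>k ` F. x ^ card K) \<le> (\<Sum>K\<in>insert {} (k ` F - {{}}). x ^ card K)"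
      using insert.prems x by (intro sum_mono2) auto
    also have "\<dots> = 1 + (\<Sum>K\<in>k ` F - {{}}. x ^ card K)"
      using insert.prems by (subst sum.insert) auto
    also have "\<dots> \<le> 1 + C"
      using C(2)[OF _ kF] insert.prems by auto
    finally show "(\<Sum>K\<in>k ` F. x ^ card K) \<le> 1 + C" .
    show "(\<Sum>L\<in>(\<lambda>U. U - k U) ` F. x ^ card L) \<le> (1 + C) ^ card A"
      using insert.prems dF by (intro insert.IH) auto
  qed (use C x in \<open>auto intro!: sum_nonneg\<close>)
  finally show ?case using insert.hyps by simp
qed

end

section \<open>Analyticity of separation probabilities\<close>

text \<open>Sigma-additivity as an unordered sum, since the pairs \<open>(i, U)\<close> come without
  a natural enumeration. The proof enumerates \<open>I\<close> and pads with empty sets.\<close>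

lemma (in finite_measure) has_sum_measure_UN:
  assumes "countable I" "\<And>i. i \<in> I \<Longrightarrow> X i \<in> sets M" "disjoint_family_on X I"
  shows "((\<lambda>i. measure M (X i)) has_sum measure M (\<Union>i\<in>I. X i)) I"
proof -
  define Y where "Y n = (if n \<in> to_nat_on I ` I then X (from_nat_into I n) else {})" for n
  have Y: "Y (to_nat_on I i) = X i" if "i \<in> I" for i
    using that assms(1) by (auto simp: Y_def)
  have "disjoint_family Y"
    unfolding disjoint_family_on_def
  proof (intro ballI impI)
    fix m n :: nat assume "m \<noteq> n"
    show "Y m \<inter> Y n = {}"
    proof (cases "m \<in> to_nat_on I ` I \<and> n \<in> to_nat_on I ` I")
      case True
      then obtain i j where "i \<in> I" "j \<in> I" "m = to_nat_on I i" "n = to_nat_on I j" by auto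
      moreover from this have "i \<noteq> j" using \<open>m \<noteq> n\<close> by auto
      ultimately show ?thesis using assms(3) Y by (simp add: disjoint_family_on_def)
    qed (auto simp: Y_def)
  qed
  moreover have "range Y \<subseteq> sets M"
    using assms(1,2) by (auto simp: Y_def)
  ultimately have "(\<lambda>n. measure M (Y n)) sums measure M (\<Union>n. Y n)"
    by (intro finite_measure_UNION)
  then have "((\<lambda>n. measure M (Y n)) has_sum measure M (\<Union>n. Y n)) UNIV"
    by (rule sums_nonneg_imp_has_sum) simp
  also have "(\<Union>n. Y n) = (\<Union>i\<in>I. X i)"
  proof
    show "(\<Union>n. Y n) \<subseteq> (\<Union>i\<in>I. X i)"
      using Y by (auto simp: Y_def split: if_splits)
    show "(\<Union>i\<in>I. X i) \<subseteq> (\<Union>n. Y n)"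
      using Y by blast
  qed
  also have "((\<lambda>n. measure M (Y n)) has_sum measure M (\<Union>i\<in>I. X i)) UNIV \<longleftrightarrow>
      ((\<lambda>n. measure M (Y n)) has_sum measure M (\<Union>i\<in>I. X i)) (to_nat_on I ` I)"
    by (rule has_sum_cong_neutral) (auto simp: Y_def)
  also have "\<dots> \<longleftrightarrow> ((\<lambda>i. measure M (Y (to_nat_on I i))) has_sum measure M (\<Union>i\<in>I. X i)) I"
    using assms(1) by (subst has_sum_reindex) (auto simp: o_def)
  also have "\<dots> \<longleftrightarrow> ((\<lambda>i. measure M (X i)) has_sum measure M (\<Union>i\<in>I. X i)) I"
    by (rule has_sum_cong) (simp add: Y)
  finally show ?thesis .
qed

text \<open>Continuity from below along an enumeration: a uniform bound on finite partial sums is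
  enough, without any summability argument.\<close>

lemma (in finite_measure) measure_UN_countable_le:
  assumes "countable I" "\<And>i. i \<in> I \<Longrightarrow> X i \<in> sets M"
    and "\<And>F. finite F \<Longrightarrow> F \<subseteq> I \<Longrightarrow> (\<Sum>i\<in>F. measure M (X i)) \<le> B"
  shows "measure M (\<Union>i\<in>I. X i) \<le> B"
proof (cases "I = {}")
  case True
  then show ?thesis using assms(3)[of "{}"] by simp
next
  case False
  define D where "D n = (\<Union>i\<in>from_nat_into I ` {..n}. X i)" for n
  have sub: "from_nat_into I ` N \<subseteq> I" for N
    using False by (auto intro: from_nat_into)
  have D_sets: "range D \<subseteq> sets M"
    using sub assms(2) unfolding D_def by (intro image_subsetI sets.finite_UN) auto
  have "incseq D" by (force simp: D_def incseq_def)
  have "(\<Union>n. D n) = (\<Union>i\<in>I. X i)"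
  proof
    show "(\<Union>n. D n) \<subseteq> (\<Union>i\<in>I. X i)" using sub by (force simp: D_def)
    show "(\<Union>i\<in>I. X i) \<subseteq> (\<Union>n. D n)"
    proof
      fix x assume "x \<in> (\<Union>i\<in>I. X i)"
      then obtain i where "i \<in> I" "x \<in> X i" by auto
      then obtain n where "from_nat_into I n = i"
        using from_nat_into_surj[OF assms(1)] by auto
      then show "x \<in> (\<Union>n. D n)" using \<open>x \<in> X i\<close> by (auto simp: D_def)
    qed
  qed
  then have "(\<lambda>n. measure M (D n)) \<longlonglongrightarrow> measure M (\<Union>i\<in>I. X i)"
    using finite_Lim_measure_incseq[OF D_sets \<open>incseq D\<close>] by simp
  moreover have "measure M (D n) \<le> B" for n
  proof -
    have "measure M (D n) \<le> (\<Sum>i\<in>from_nat_into I ` {..n}. measure M (X i))"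
      unfolding D_def using sub[of "{..n}"] assms(2)
      by (intro finite_measure_subadditive_finite) auto
    also have "\<dots> \<le> B" using sub by (intro assms(3)) auto
    finally show ?thesis .
  qed
  ultimately show ?thesis
    by (intro LIMSEQ_le_const2) auto
qed

text \<open>Isolates all that the analytic part uses of the graph: a sequence of edges and a
  property \<open>Sep\<close> whose connected witnesses through the \<open>i\<close>-th edge have at
  least \<open>i / c\<close> elements.\<close>

locale separation = bounded_relation +
  fixes ed :: "nat \<Rightarrow> 'a set" and Sep :: "'a set set \<Rightarrow> bool" and c :: nat
  assumes ed_E: "\<And>i. ed i \<in> E"
    and c_pos: "0 < c"
    and Sep_size: "\<And>i K. K \<in> conn (ed i) \<Longrightarrow> Sep K \<Longrightarrow> i \<le> c * card K"
begin

definition sep_at :: "'a set set \<Rightarrow> nat \<Rightarrow> bool" where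
  "sep_at W i \<longleftrightarrow> ed i \<in> W \<and> Sep (reach H {ed i} W)"

text \<open>
  \<open>first_sep\<close> collects the pairs \<open>(i, U)\<close> for which the union \<open>U\<close> of the vacant clusters of
  \<open>ed 0, \<dots>, ed i\<close> shows that \<open>i\<close> is the least index with a separating cluster. Taking the least index
  makes the events disjoint and avoids inclusion-exclusion.
\<close>

definition first_sep :: "(nat \<times> 'a set set) set" where
  "first_sep = {(i, U). U \<in> valid (ed ` {..i}) \<and> sep_at U i \<and> (\<forall>j<i. \<not> sep_at U j)}"

definition sep_event :: "('a set \<Rightarrow> bool) set" where
  "sep_event = {\<omega> \<in> space (percolation E 0). \<exists>i. sep_at (vac \<omega>) i}"

abbreviation growth :: real where
  "growth \<equiv> (real \<Delta> - 1) * exp 1"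

lemma growth_ge_1: "1 \<le> growth"
proof -
  have "1 * 1 \<le> (real \<Delta> - 1) * exp (1::real)"
    using \<Delta>_ge_2 by (intro mult_mono) auto
  then show ?thesis by simp
qed

lemma countable_finite_edge_sets: "countable {U. finite U \<and> U \<subseteq> E}"
  using countable_E by (rule countable_Collect_finite_subset)

lemma countable_conn: "countable (conn e)"
  by (rule countable_subset[OF _ countable_finite_edge_sets]) (auto simp: conn_def)

lemma countable_first_sep: "countable first_sep"
proof (rule countable_subset)
  show "first_sep \<subseteq> UNIV \<times> {U. finite U \<and> U \<subseteq> E}"
    by (auto simp: first_sep_def valid_def)
  show "countable (UNIV \<times> {U. finite U \<and> U \<subseteq> E} :: (nat \<times> 'a set set) set)"
    using countable_finite_edge_sets by (intro countable_SIGMA) auto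
qed

lemma ed_image: "ed ` X \<subseteq> E"
  using ed_E by auto

text \<open>Makes the condition in \<open>first_sep\<close> a condition on \<open>U\<close> alone,
  although it speaks about the vacant clusters of the whole configuration.\<close>

lemma sep_at_reach: "j \<le> i \<Longrightarrow> sep_at (reach H (ed ` {..i}) W) j \<longleftrightarrow> sep_at W j"
proof -
  assume "j \<le> i"
  then have 1: "reach H {ed j} (reach H (ed ` {..i}) W) = reach H {ed j} W"
    by (intro reach_restrict) auto
  have "ed j \<in> reach H (ed ` {..i}) W \<longleftrightarrow> ed j \<in> W"
    using \<open>j \<le> i\<close> reach_base[of "ed ` {..i}" W H] reach_subset[of H "ed ` {..i}" W] by auto
  then show ?thesis using 1 by (simp add: sep_at_def)
qed

definition first_event :: "nat \<times> 'a set set \<Rightarrow> ('a set \<Rightarrow> bool) set" where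
  "first_event = (\<lambda>(i, U). {\<omega> \<in> space (percolation E 0). reach H (ed ` {..i}) (vac \<omega>) = U})"

text \<open>Generic over rings, so that one polynomial serves as the probability at a real parameter
  and as its extension to complex ones.\<close>

definition weight :: "'b::comm_ring_1 \<Rightarrow> nat \<times> 'a set set \<Rightarrow> 'b" where
  "weight p = (\<lambda>(i, U). (1 - p) ^ card U * p ^ card (bd H (ed ` {..i}) U))"

lemma disjoint_first_event: "disjoint_family_on first_event first_sep"
  unfolding disjoint_family_on_def
proof (intro ballI impI)
  fix x y assume xy: "x \<in> first_sep" "y \<in> first_sep" "x \<noteq> y"
  obtain i U j U' where eq: "x = (i, U)" "y = (j, U')" by (cases x, cases y)
  show "first_event x \<inter> first_event y = {}"
  proof (rule ccontr)
    assume "first_event x \<inter> first_event y \<noteq> {}"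
    then obtain \<omega> where \<omega>: "reach H (ed ` {..i}) (vac \<omega>) = U" "reach H (ed ` {..j}) (vac \<omega>) = U'"
      by (auto simp: first_event_def eq)
    have "sep_at (vac \<omega>) i" "\<And>k. k < i \<Longrightarrow> \<not> sep_at (vac \<omega>) k"
      using xy(1) sep_at_reach[of _ i "vac \<omega>"] unfolding eq \<omega> first_sep_def by auto
    moreover have "sep_at (vac \<omega>) j" "\<And>k. k < j \<Longrightarrow> \<not> sep_at (vac \<omega>) k"
      using xy(2) sep_at_reach[of _ j "vac \<omega>"] unfolding eq \<omega> first_sep_def by auto
    ultimately have "i = j" by (metis linorder_neqE_nat)
    then show False using \<omega> xy eq by auto
  qed
qed

lemma first_event_sets: "x \<in> first_sep \<Longrightarrow> first_event x \<in> sets (percolation E p)"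
  using reach_event[of "snd x" "ed ` {..fst x}" p] ed_image
  by (auto simp: first_sep_def first_event_def space_percolation)

lemma measure_first_event:
  "x \<in> first_sep \<Longrightarrow> 0 \<le> p \<Longrightarrow> p \<le> 1 \<Longrightarrow> measure (percolation E p) (first_event x) = weight p x"
  using measure_reach_event[of "snd x" "ed ` {..fst x}" p] ed_image
  by (auto simp: first_sep_def first_event_def weight_def space_percolation)

text \<open>\<open>K\<close> need only be vacant, not a whole cluster. The event therefore also
  covers infinite clusters, and its probability is bounded by a plain sum over
  \<open>K\<close>.\<close>

definition large_event :: "'a set \<Rightarrow> nat \<Rightarrow> ('a set \<Rightarrow> bool) set" where
  "large_event e i = (\<Union>K\<in>{K \<in> conn e. i \<le> c * card K}. cyl K {})"

lemma large_event_sets: "large_event e i \<in> sets (percolation E p)"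
  unfolding large_event_def
proof (rule sets.countable_UN'')
  show "countable {K \<in> conn e. i \<le> c * card K}"
    by (rule countable_subset[OF _ countable_conn]) auto
qed (auto simp: conn_def intro!: cyl_event)

text \<open>The margin \<open>\<kappa> ^ c\<close> per edge below the critical value
  \<open>1 / growth\<close> becomes \<open>\<kappa> ^ (c * card K)\<close>, hence at most
  \<open>\<kappa> ^ i\<close>; what remains is the bounded sum over connected sets.\<close>

lemma measure_large_event:
  assumes e: "e \<in> E" and p: "0 \<le> p" "p \<le> 1"
    and \<kappa>: "0 < \<kappa>" "\<kappa> \<le> 1" "(1 - p) * growth \<le> \<kappa> ^ c"
    and C: "\<And>F. F \<subseteq> conn e \<Longrightarrow> finite F \<Longrightarrow> (\<Sum>K\<in>F. (1 / growth) ^ card K) \<le> C"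
  shows "measure (percolation E p) (large_event e i) \<le> C * \<kappa> ^ i"
proof -
  interpret prob_space "percolation E p" by (rule prob_space_percolation)
  show ?thesis
    unfolding large_event_def
  proof (rule measure_UN_countable_le)
    show "countable {K \<in> conn e. i \<le> c * card K}"
      by (rule countable_subset[OF _ countable_conn]) auto
    show "cyl K {} \<in> events" if "K \<in> {K \<in> conn e. i \<le> c * card K}" for K
      using that by (auto simp: conn_def intro!: cyl_event)
    fix F assume F: "finite F" "F \<subseteq> {K \<in> conn e. i \<le> c * card K}"
    have "(\<Sum>K\<in>F. prob (cyl K {})) = (\<Sum>K\<in>F. (1 - p) ^ card K)"
      using F p by (intro sum.cong HOL.refl, subst measure_cyl) (auto simp: conn_def)
    also have "\<dots> \<le> (\<Sum>K\<in>F. \<kappa> ^ i * (1 / growth) ^ card K)"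
    proof (intro sum_mono)
      fix K assume "K \<in> F"
      then have i: "i \<le> c * card K" using F by auto
      have "1 - p \<le> \<kappa> ^ c * (1 / growth)"
        using \<kappa>(3) growth_ge_1 by (simp add: pos_le_divide_eq)
      then have "(1 - p) ^ card K \<le> (\<kappa> ^ c * (1 / growth)) ^ card K"
        using p by (intro power_mono) auto
      also have "\<dots> = \<kappa> ^ (c * card K) * (1 / growth) ^ card K"
        by (simp only: power_mult_distrib power_mult)
      also have "\<dots> \<le> \<kappa> ^ i * (1 / growth) ^ card K"
        using \<kappa> i growth_ge_1 by (intro mult_right_mono power_decreasing zero_le_power) auto
      finally show "(1 - p) ^ card K \<le> \<kappa> ^ i * (1 / growth) ^ card K" .
    qed
    also have "\<dots> = \<kappa> ^ i * (\<Sum>K\<in>F. (1 / growth) ^ card K)"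
      by (simp add: sum_distrib_left)
    also have "\<dots> \<le> \<kappa> ^ i * C"
      using F \<kappa> by (intro mult_left_mono C) auto
    finally show "(\<Sum>K\<in>F. prob (cyl K {})) \<le> C * \<kappa> ^ i" by (simp add: mult.commute)
  qed
qed

lemma infinite_reach_large:
  assumes "infinite (reach H {e} (vac \<omega>))" "\<omega> \<in> space (percolation E 0)"
  shows "\<omega> \<in> large_event e i"
proof -
  let ?K = "reach H {e} (vac \<omega>)"
  have sub: "?K \<subseteq> vac \<omega>" by (rule reach_subset)
  have "e \<in> vac \<omega>"
    using assms(1) reach_least[of "{e}" "vac \<omega>" "{}" H] by (cases "e \<in> vac \<omega>") auto
  then have e: "e \<in> ?K" using reach_base[of "{e}" "vac \<omega>" H] by auto
  have "?K \<subseteq> E" using sub by (auto simp: vac_def)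
  then obtain K' where K': "K' \<in> conn e" "K' \<subseteq> ?K" "card K' = Suc i"
    using exists_conn_subset[OF _ e reach_idem, of i] assms(1) by auto
  have "i \<le> 1 * Suc i" by simp
  also have "\<dots> \<le> c * Suc i" using c_pos by (intro mult_right_mono) auto
  finally have "i \<le> c * card K'" using K' by simp
  moreover have "\<omega> \<in> cyl K' {}"
    using K'(2) sub assms(2) by (auto simp: cyl_def vac_def)
  ultimately show ?thesis
    using K' by (auto simp: large_event_def)
qed

text \<open>A configuration with an infinite vacant cluster at \<open>e\<close> lies in
  \<open>large_event e i\<close> for every \<open>i\<close>, and these events have probabilities
  tending to 0.\<close>

lemma AE_finite_reach:
  assumes e: "e \<in> E" and p: "0 \<le> p" "p \<le> 1" "(1 - p) * growth < 1"
  shows "AE \<omega> in percolation E p. finite (reach H {e} (vac \<omega>))"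
proof -
  interpret prob_space "percolation E p" by (rule prob_space_percolation)
  obtain C :: real where C: "C \<ge> 0" "\<And>F. F \<subseteq> conn e \<Longrightarrow> finite F \<Longrightarrow> (\<Sum>K\<in>F. (1 / growth) ^ card K) \<le> C"
    using growth_constant e by metis
  \<comment> \<open>The maximum with \<open>1/2\<close> keeps \<open>\<kappa>\<close> positive at
    \<open>p = 1\<close>.\<close>
  define \<kappa> where "\<kappa> = root c (max ((1 - p) * growth) (1/2))"
  have \<kappa>: "\<kappa> ^ c = max ((1 - p) * growth) (1/2)" "0 < \<kappa>" "\<kappa> < 1"
    using c_pos p by (auto simp: \<kappa>_def)
  let ?N = "\<Inter>i. large_event e i"
  have N: "?N \<in> events" using large_event_sets by auto
  have "(\<lambda>i. C * \<kappa> ^ i) \<longlonglongrightarrow> C * 0"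
    using \<kappa> by (intro tendsto_mult_left LIMSEQ_realpow_zero) auto
  moreover have "prob ?N \<le> C * \<kappa> ^ i" for i
  proof -
    have "prob ?N \<le> prob (large_event e i)"
      using large_event_sets by (intro finite_measure_mono) auto
    also have "\<dots> \<le> C * \<kappa> ^ i"
      using \<kappa> e p C by (intro measure_large_event) auto
    finally show ?thesis .
  qed
  ultimately have "prob ?N \<le> 0"
    by (intro LIMSEQ_le_const[where X = "\<lambda>i. C * \<kappa> ^ i"]) auto
  then have "prob ?N = 0" by (simp add: measure_le_0_iff)
  then have "?N \<in> null_sets (percolation E p)"
    using N by (auto simp: null_sets_def emeasure_eq_measure)
  then show ?thesis
    by (rule AE_I') (use infinite_reach_large in \<open>auto simp: space_percolation\<close>)
qed

text \<open>\<open>first_sep\<close> only records finite unions, so the decomposition covers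
  \<open>sep_event\<close> up to the null set on which some ray edge has an infinite vacant
  cluster.\<close>

lemma has_sum_sep_event:
  assumes p: "0 \<le> p" "p \<le> 1" "(1 - p) * growth < 1"
    and sep: "sep_event \<in> sets (percolation E p)"
  shows "(weight p has_sum measure (percolation E p) sep_event) first_sep"
proof -
  interpret prob_space "percolation E p" by (rule prob_space_percolation)
  have "(weight p has_sum prob (\<Union>x\<in>first_sep. first_event x)) first_sep \<longleftrightarrow>
      ((\<lambda>x. prob (first_event x)) has_sum prob (\<Union>x\<in>first_sep. first_event x)) first_sep"
    using p by (intro has_sum_cong) (simp add: measure_first_event)
  then have 1: "(weight p has_sum prob (\<Union>x\<in>first_sep. first_event x)) first_sep"
    using has_sum_measure_UN[OF countable_first_sep first_event_sets disjoint_first_event] by blast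
  have "AE \<omega> in percolation E p. \<forall>i. finite (reach H {ed i} (vac \<omega>))"
    using AE_finite_reach[OF ed_E p] by (simp add: AE_all_countable)
  then have "AE \<omega> in percolation E p. \<omega> \<in> (\<Union>x\<in>first_sep. first_event x) \<longleftrightarrow> \<omega> \<in> sep_event"
    using AE_space
  proof eventually_elim
    case (elim \<omega>)
    show ?case
    proof
      assume "\<omega> \<in> (\<Union>x\<in>first_sep. first_event x)"
      then obtain i U where U: "(i, U) \<in> first_sep" "reach H (ed ` {..i}) (vac \<omega>) = U"
        by (auto simp: first_event_def)
      then have "sep_at (vac \<omega>) i"
        using sep_at_reach[of i i "vac \<omega>"] by (auto simp: first_sep_def)
      then show "\<omega> \<in> sep_event"
        using elim(2) by (auto simp: sep_event_def space_percolation)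
    next
      assume "\<omega> \<in> sep_event"
      then have ex: "\<exists>i. sep_at (vac \<omega>) i" by (simp add: sep_event_def)
      define i where "i = (LEAST i. sep_at (vac \<omega>) i)"
      have i: "sep_at (vac \<omega>) i" "\<And>j. j < i \<Longrightarrow> \<not> sep_at (vac \<omega>) j"
        using LeastI_ex[OF ex] not_less_Least unfolding i_def by blast+
      define U where "U = reach H (ed ` {..i}) (vac \<omega>)"
      have "U = (\<Union>j\<in>{..i}. reach H {ed j} (vac \<omega>))"
        by (auto simp: U_def reach_def)
      then have "finite U" using elim(1) by auto
      moreover have "U \<subseteq> E" using reach_subset[of H _ "vac \<omega>"] by (auto simp: U_def vac_def)
      ultimately have "U \<in> valid (ed ` {..i})"
        by (simp add: valid_def U_def reach_idem)
      then have "(i, U) \<in> first_sep"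
        using i by (simp add: first_sep_def U_def sep_at_reach)
      moreover have "\<omega> \<in> first_event (i, U)"
        using elim(2) by (simp add: first_event_def U_def space_percolation)
      ultimately show "\<omega> \<in> (\<Union>x\<in>first_sep. first_event x)" by blast
    qed
  qed
  moreover have "(\<Union>x\<in>first_sep. first_event x) \<in> events"
    using countable_first_sep first_event_sets by (intro sets.countable_UN'') auto
  ultimately have "prob (\<Union>x\<in>first_sep. first_event x) = prob sep_event"
    using sep by (intro finite_measure_eq_AE) auto
  then show ?thesis using 1 by simp
qed

text \<open>Sets \<open>U\<close> with at most \<open>L * (i + 1)\<close> elements are handled by the probability that the cluster of \<open>ed i\<close>
  has size at least \<open>i / c\<close>, larger ones by counting.\<close>

lemma sum_weight_level_le:
  fixes F :: "'a set set set"
  assumes F: "finite F" "\<And>U. U \<in> F \<Longrightarrow> (i, U) \<in> first_sep"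
    and p: "0 \<le> p" "p \<le> 1"
    and \<kappa>: "0 < \<kappa>" "\<kappa> \<le> 1" "(1 - p) * growth \<le> \<kappa> ^ (2 * c)"
    and C: "C \<ge> 0" "\<And>e F. e \<in> E \<Longrightarrow> F \<subseteq> conn e \<Longrightarrow> finite F \<Longrightarrow>
       (\<Sum>K\<in>F. (1 / growth) ^ card K) \<le> C"
    and t: "1 \<le> t" "t * \<kappa> ^ c \<le> 1"
  shows "(\<Sum>U\<in>F. weight p (i, U) * t ^ card U)
    \<le> t ^ (L * (i + 1)) * (C * \<kappa> ^ i) + (\<kappa> ^ (c * L) * (1 + C)) ^ (i + 1)"
proof -
  interpret prob_space "percolation E p" by (rule prob_space_percolation)
  have valid: "U \<in> valid (ed ` {..i})" "sep_at U i" if "U \<in> F" for U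
    using F(2)[OF that] by (auto simp: first_sep_def)
  have w_nonneg: "0 \<le> weight p (i, U)" for U
    using p by (auto simp: weight_def)
  \<comment> \<open>Without the powers of \<open>t\<close> the terms are probabilities of disjoint
    events, all contained in \<open>large_event (ed i) i\<close> because the cluster of
    \<open>ed i\<close> separates.\<close>
  have "(\<Sum>U\<in>F. weight p (i, U)) \<le> C * \<kappa> ^ i"
  proof -
    have "(\<Sum>U\<in>F. weight p (i, U)) =
        prob {\<omega> \<in> space (percolation E p). reach H (ed ` {..i}) (vac \<omega>) \<in> F}"
      unfolding weight_def using F valid p by (simp add: sum_reach_events ed_image subsetI)
    also have "\<dots> \<le> prob (large_event (ed i) i)"
    proof (rule finite_measure_mono[OF _ large_event_sets], safe)
      fix \<omega> assume \<omega>: "\<omega> \<in> space (percolation E p)" and U: "reach H (ed ` {..i}) (vac \<omega>) \<in> F"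
      let ?U = "reach H (ed ` {..i}) (vac \<omega>)" and ?K = "reach H {ed i} (vac \<omega>)"
      have "?K \<subseteq> ?U" by (rule reach_mono) auto
      have "?U \<subseteq> E" "finite ?U" using valid(1)[OF U] by (auto simp: valid_def)
      then have "?K \<subseteq> E" "finite ?K" using \<open>?K \<subseteq> ?U\<close> by (auto intro: finite_subset)
      have sep: "sep_at (vac \<omega>) i" using valid(2)[OF U] by (simp add: sep_at_reach)
      then have "ed i \<in> ?K" using reach_base[of "{ed i}" "vac \<omega>" H] by (auto simp: sep_at_def)
      then have K: "?K \<in> conn (ed i)"
        using \<open>?K \<subseteq> E\<close> \<open>finite ?K\<close> by (simp add: conn_def reach_idem)
      moreover have "i \<le> c * card ?K" using Sep_size[OF K] sep by (simp add: sep_at_def)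
      moreover have "\<omega> \<in> cyl ?K {}"
        using \<omega> reach_subset[of H "{ed i}" "vac \<omega>"] by (auto simp: cyl_def space_percolation vac_def)
      ultimately show "\<omega> \<in> large_event (ed i) i" by (auto simp: large_event_def)
    qed
    also have "\<dots> \<le> C * \<kappa> ^ i"
    proof (rule measure_large_event[OF ed_E p \<kappa>(1,2)])
      have "\<kappa> ^ (2 * c) \<le> \<kappa> ^ c" using \<kappa> by (intro power_decreasing) auto
      then show "(1 - p) * growth \<le> \<kappa> ^ c" using \<kappa>(3) by simp
    qed (use C ed_E in auto)
    finally show ?thesis .
  qed
  then have low: "(\<Sum>U\<in>F. t ^ (L * (i + 1)) * weight p (i, U)) \<le> t ^ (L * (i + 1)) * (C * \<kappa> ^ i)"
    using t unfolding sum_distrib_left[symmetric] by (intro mult_left_mono) auto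
  have high: "(\<Sum>U\<in>F. \<kappa> ^ (c * L * (i + 1)) * (1 / growth) ^ card U) \<le> (\<kappa> ^ (c * L) * (1 + C)) ^ (i + 1)"
  proof -
    have "(\<Sum>U\<in>F. (1 / growth) ^ card U) \<le> (1 + C) ^ card (ed ` {..i})"
      using C F valid growth_ge_1 by (intro sum_valid_le ed_image) auto
    also have "\<dots> \<le> (1 + C) ^ (i + 1)"
      using C card_image_le[of "{..i}" ed] by (intro power_increasing) auto
    finally have "\<kappa> ^ (c * L * (i + 1)) * (\<Sum>U\<in>F. (1 / growth) ^ card U) \<le> \<kappa> ^ (c * L * (i + 1)) * (1 + C) ^ (i + 1)"
      using \<kappa> by (intro mult_left_mono) auto
    also have "\<dots> = (\<kappa> ^ (c * L) * (1 + C)) ^ (i + 1)"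
      by (simp only: power_mult_distrib power_mult)
    finally show ?thesis by (simp only: sum_distrib_left)
  qed
  have "(\<Sum>U\<in>F. weight p (i, U) * t ^ card U)
    \<le> (\<Sum>U\<in>F. t ^ (L * (i + 1)) * weight p (i, U) + \<kappa> ^ (c * L * (i + 1)) * (1 / growth) ^ card U)"
  proof (rule sum_mono)
    fix U assume "U \<in> F"
    show "weight p (i, U) * t ^ card U
      \<le> t ^ (L * (i + 1)) * weight p (i, U) + \<kappa> ^ (c * L * (i + 1)) * (1 / growth) ^ card U"
    proof (cases "card U \<le> L * (i + 1)")
      case True
      then have "t ^ card U * weight p (i, U) \<le> t ^ (L * (i + 1)) * weight p (i, U)"
        using t w_nonneg by (intro mult_right_mono power_increasing) auto
      moreover have "0 \<le> \<kappa> ^ (c * L * (i + 1)) * (1 / growth) ^ card U"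
        using \<kappa> growth_ge_1 by (intro mult_nonneg_nonneg zero_le_power) auto
      ultimately show ?thesis by (simp add: mult.commute)
    next
      case False
      \<comment> \<open>Of the margin \<open>\<kappa> ^ (2 * c)\<close>, one factor
        \<open>\<kappa> ^ c\<close> absorbs \<open>t\<close> and the other remains as decay per edge
        of \<open>U\<close>.\<close>
      have "(1 - p) * t * growth = t * ((1 - p) * growth)" by simp
      also have "\<dots> \<le> t * \<kappa> ^ (2 * c)" using \<kappa> t by (intro mult_left_mono) auto
      also have "\<dots> = (t * \<kappa> ^ c) * \<kappa> ^ c" by (simp add: mult_2 power_add)
      also have "\<dots> \<le> 1 * \<kappa> ^ c" using t \<kappa> by (intro mult_right_mono) auto
      finally have le: "(1 - p) * t \<le> \<kappa> ^ c * (1 / growth)"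
        using growth_ge_1 by (simp add: pos_le_divide_eq)
      have "weight p (i, U) \<le> (1 - p) ^ card U"
        using p by (auto simp: weight_def intro!: mult_left_le power_le_one)
      then have "weight p (i, U) * t ^ card U \<le> (1 - p) ^ card U * t ^ card U"
        using t by (intro mult_right_mono) auto
      also have "\<dots> = ((1 - p) * t) ^ card U" by (simp only: power_mult_distrib)
      also have "\<dots> \<le> (\<kappa> ^ c * (1 / growth)) ^ card U"
        using le p t by (intro power_mono) auto
      also have "\<dots> = \<kappa> ^ (c * card U) * (1 / growth) ^ card U"
        by (simp only: power_mult_distrib power_mult)
      also have "\<dots> \<le> \<kappa> ^ (c * (L * (i + 1))) * (1 / growth) ^ card U"
        using \<kappa> False growth_ge_1
        by (intro mult_right_mono power_decreasing zero_le_power mult_left_mono) auto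
      finally have "weight p (i, U) * t ^ card U \<le> \<kappa> ^ (c * L * (i + 1)) * (1 / growth) ^ card U"
        by (simp only: mult.assoc)
      moreover have "0 \<le> t ^ (L * (i + 1)) * weight p (i, U)"
        using t w_nonneg by auto
      ultimately show ?thesis by linarith
    qed
  qed
  also have "\<dots> \<le> t ^ (L * (i + 1)) * (C * \<kappa> ^ i) + (\<kappa> ^ (c * L) * (1 + C)) ^ (i + 1)"
    unfolding sum.distrib using low high by (rule add_mono)
  finally show ?thesis .
qed

text \<open>\<open>t\<close> depends on \<open>\<kappa>\<close> but not on \<open>p\<close>. This
  order of choice matters: the comparison parameter \<open>p\<close> is fixed later, from a radius
  that itself depends on \<open>t\<close>.\<close>

lemma summable_weight:
  assumes \<kappa>: "0 < \<kappa>" "\<kappa> < 1"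
  obtains t :: real where "t > 1"
    "\<forall>p. 0 \<le> p \<and> p \<le> 1 \<and> (1 - p) * growth \<le> \<kappa> ^ (2 * c) \<longrightarrow>
      (\<lambda>(i, U). weight p (i, U) * t ^ (card U + i + 1)) summable_on first_sep"
proof -
  obtain C :: real where C: "C \<ge> 0" "\<And>e F. e \<in> E \<Longrightarrow> F \<subseteq> conn e \<Longrightarrow> finite F \<Longrightarrow> (\<Sum>K\<in>F. (1 / growth) ^ card K) \<le> C"
    using growth_constant by metis
  have kc: "0 < \<kappa> ^ c" "\<kappa> ^ c < 1" using \<kappa> c_pos by (auto intro: power_Suc_less_one simp: power_less_one_iff)
  \<comment> \<open>\<open>L\<close> is chosen so large that the decay of sets with more than
    \<open>L * (i + 1)\<close> edges beats the counting factor
    \<open>(1 + C) ^ (i + 1)\<close>.\<close>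
  have "(\<lambda>L. (\<kappa> ^ c) ^ L * (1 + C)) \<longlonglongrightarrow> 0 * (1 + C)"
    using kc by (intro tendsto_mult LIMSEQ_realpow_zero tendsto_const) auto
  then have "eventually (\<lambda>L. (\<kappa> ^ c) ^ L * (1 + C) < 1/4) sequentially"
    by (rule order_tendstoD) simp
  then obtain L where "(\<kappa> ^ c) ^ L * (1 + C) < 1/4"
    by (auto simp: eventually_sequentially)
  then have L: "\<kappa> ^ (c * L) * (1 + C) < 1/4" by (simp add: power_mult)
  define \<mu> where "\<mu> = (1 + \<kappa>) / 2"
  have \<mu>: "\<kappa> < \<mu>" "\<mu> < 1" "0 < \<mu>" using \<kappa> by (auto simp: \<mu>_def)
  \<comment> \<open>With \<open>L\<close> fixed, \<open>t\<close> close to 1 leaves geometric decay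
    for the small sets; \<open>t < 2\<close> will turn the bound \<open>1/4\<close> for the large
    ones into \<open>1/2\<close>.\<close>
  have "((\<lambda>t. t ^ (L + 1) * \<kappa>) \<longlongrightarrow> 1 ^ (L + 1) * \<kappa>) (at_right 1)"
    by (intro tendsto_intros)
  then have "eventually (\<lambda>t. t ^ (L + 1) * \<kappa> < \<mu>) (at_right 1)"
    by (rule order_tendstoD) (use \<mu> in simp)
  moreover have "((\<lambda>t. t * \<kappa> ^ c) \<longlongrightarrow> 1 * \<kappa> ^ c) (at_right 1)"
    by (intro tendsto_intros)
  then have "eventually (\<lambda>t. t * \<kappa> ^ c < 1) (at_right 1)"
    by (rule order_tendstoD) (use kc in simp)
  moreover have "eventually (\<lambda>t::real. t \<in> {1<..<2}) (at_right 1)"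
    by (rule eventually_at_right_real) simp
  ultimately have "eventually (\<lambda>t. t ^ (L + 1) * \<kappa> < \<mu> \<and> t * \<kappa> ^ c < 1 \<and> t \<in> {1<..<2}) (at_right 1)"
    by eventually_elim auto
  then obtain t where t: "t ^ (L + 1) * \<kappa> < \<mu>" "t * \<kappa> ^ c < 1" "1 < t" "t < 2"
    using eventually_happens[of _ "at_right (1::real)"] by (auto simp: trivial_limit_at_right_real)
  define s where "s i = t ^ (L + 1) * C * \<mu> ^ i + (1/2) ^ (i + 1)" for i :: nat
  have s: "summable s" "\<And>i. 0 \<le> s i"
    using \<mu> C t unfolding s_def by (auto intro!: summable_add summable_mult summable_geometric)
  show ?thesis
  proof (rule that[OF t(3)], intro allI impI, elim conjE)
    fix p :: real assume p: "0 \<le> p" "p \<le> 1" "(1 - p) * growth \<le> \<kappa> ^ (2 * c)"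
    let ?M = "\<lambda>(i, U). weight p (i, U) * t ^ (card U + i + 1)"
    have level: "(\<Sum>U\<in>F. ?M (i, U)) \<le> s i"
      if F: "finite F" "\<And>U. U \<in> F \<Longrightarrow> (i, U) \<in> first_sep" for F i
    proof -
      have "(\<Sum>U\<in>F. ?M (i, U)) = t ^ (i + 1) * (\<Sum>U\<in>F. weight p (i, U) * t ^ card U)"
        by (simp add: sum_distrib_left power_add mult_ac)
      also have "\<dots> \<le> t ^ (i + 1) * (t ^ (L * (i + 1)) * (C * \<kappa> ^ i) + (\<kappa> ^ (c * L) * (1 + C)) ^ (i + 1))"
        using F p C t \<kappa> by (intro mult_left_mono sum_weight_level_le) auto
      also have "\<dots> = t ^ (L + 1) * C * (t ^ (L + 1) * \<kappa>) ^ i + (t * (\<kappa> ^ (c * L) * (1 + C))) ^ (i + 1)"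
      proof -
        have "t ^ (i + 1) * t ^ (L * (i + 1)) = t ^ ((L + 1) + (L + 1) * i)"
          unfolding power_add[symmetric] by (rule arg_cong[of _ _ "power t"]) (simp add: algebra_simps)
        then have "t ^ (i + 1) * t ^ (L * (i + 1)) = t ^ (L + 1) * (t ^ (L + 1)) ^ i"
          by (simp only: power_add power_mult)
        then show ?thesis
          unfolding distrib_left[of "t ^ (i + 1)"] power_mult_distrib[of t] power_mult_distrib[of "t ^ (L + 1)"]
          by (simp only: mult_ac)
      qed
      also have "\<dots> \<le> t ^ (L + 1) * C * \<mu> ^ i + (1/2) ^ (i + 1)"
      proof (intro add_mono mult_left_mono power_mono)
        have "t * (\<kappa> ^ (c * L) * (1 + C)) \<le> 2 * (1 / 4)"
          using t L C \<kappa> by (intro mult_mono) auto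
        then show "t * (\<kappa> ^ (c * L) * (1 + C)) \<le> 1 / 2" by simp
      qed (use t \<kappa> C in auto)
      finally show ?thesis by (simp only: s_def)
    qed
    show "?M summable_on first_sep"
    proof (rule nonneg_bdd_above_summable_on)
      show "0 \<le> ?M x" if "x \<in> first_sep" for x
        using p t by (auto simp: weight_def split: prod.splits)
      show "bdd_above (sum ?M ` {F. F \<subseteq> first_sep \<and> finite F})"
      proof (rule bdd_aboveI2)
        fix F assume "F \<in> {F. F \<subseteq> first_sep \<and> finite F}"
        then have F: "F \<subseteq> first_sep" "finite F" by auto
        define G where "G i = {U. (i, U) \<in> F}" for i
        have G: "finite (G i)" for i
        proof (rule finite_subset)
          show "G i \<subseteq> snd ` F" by (force simp: G_def)
        qed (use F in simp)
        have eq: "F = Sigma (fst ` F) G" by (force simp: G_def)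
        have "sum ?M F = (\<Sum>i\<in>fst ` F. \<Sum>U\<in>G i. ?M (i, U))"
          using F(2) G by (subst eq, subst sum.Sigma) auto
        also have "\<dots> \<le> (\<Sum>i\<in>fst ` F. s i)"
          using F G by (intro sum_mono level) (auto simp: G_def)
        also have "\<dots> \<le> suminf s"
          using F s by (intro sum_le_suminf) auto
        finally show "sum ?M F \<le> suminf s" .
      qed
    qed
  qed
qed

text \<open>The event of \<open>(i, U)\<close> inspects \<open>card U\<close> vacant edges and a
  boundary of linear size, at most \<open>(\<Delta> + 1) * (card U + i + 1)\<close> edges together,
  and each costs a factor at most \<open>1 + \<epsilon>\<close>.\<close>

lemma weight_complex_bound:
  fixes z :: complex
  assumes x: "(i, U) \<in> first_sep" and "norm z \<le> p * (1 + \<epsilon>)" "norm (1 - z) \<le> (1 - p) * (1 + \<epsilon>)"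
    and "0 \<le> p" "p \<le> 1" "0 \<le> \<epsilon>"
  shows "norm (weight z (i, U)) \<le> weight p (i, U) * ((1 + \<epsilon>) ^ (\<Delta> + 1)) ^ (card U + i + 1)"
proof -
  define b where "b = card (bd H (ed ` {..i}) U)"
  have "b \<le> card (ed ` {..i}) + \<Delta> * card U"
    unfolding b_def using x by (intro card_bd) (auto simp: first_sep_def valid_def)
  also have "card (ed ` {..i}) \<le> i + 1"
    using card_image_le[of "{..i}" ed] by simp
  finally have b: "card U + b \<le> (\<Delta> + 1) * (card U + i + 1)"
    by (simp add: algebra_simps)
  have "norm (weight z (i, U)) = norm (1 - z) ^ card U * norm z ^ b"
    by (simp add: weight_def norm_mult norm_power b_def)
  also have "\<dots> \<le> ((1 - p) * (1 + \<epsilon>)) ^ card U * (p * (1 + \<epsilon>)) ^ b"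
    using assms by (intro mult_mono power_mono) auto
  also have "\<dots> = weight p (i, U) * (1 + \<epsilon>) ^ (card U + b)"
    by (simp add: weight_def b_def power_mult_distrib power_add)
  also have "\<dots> \<le> weight p (i, U) * (1 + \<epsilon>) ^ ((\<Delta> + 1) * (card U + i + 1))"
    using assms b by (intro mult_left_mono power_increasing) (auto simp: weight_def)
  finally show ?thesis by (simp only: power_mult)
qed

lemma weight_holomorphic: "(\<lambda>z. weight z x) holomorphic_on X"
  by (cases x) (auto simp: weight_def intro!: holomorphic_intros)

lemma weight_of_real: "weight (of_real p) x = of_real (weight p x)"
  by (cases x) (simp add: weight_def)

theorem analytic_sep_event:
  assumes sep: "\<And>p. sep_event \<in> sets (percolation E p)"
  shows "real_analytic_on (\<lambda>p. measure (percolation E p) sep_event) {1 - 1 / growth<..1}"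
  unfolding real_analytic_on_def
proof (intro ballI)
  fix x assume "x \<in> {1 - 1 / growth<..1}"
  then have x: "1 - 1 / growth < x" "x \<le> 1" by auto
  have g: "0 < growth" "1 \<le> growth" using growth_ge_1 by linarith+
  have "0 \<le> 1 - 1 / growth" using g by simp
  then have x0: "0 < x" using x by linarith
  define q where "q = max ((1 - x) * growth) (1 / 2)"
  have "(1 - x) * growth < 1" using x g by (simp add: field_simps)
  then have q: "0 < q" "q < 1" "(1 - x) * growth \<le> q" by (auto simp: q_def)
  \<comment> \<open>\<open>\<kappa> ^ (2 * c)\<close> is halfway between \<open>q\<close> and 1; the
    gap \<open>(1 - q) / 2\<close> leaves room for moving from \<open>x\<close> to
    \<open>p\<close>.\<close>
  define \<kappa> where "\<kappa> = root (2 * c) ((1 + q) / 2)"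
  have \<kappa>: "0 < \<kappa>" "\<kappa> < 1" "\<kappa> ^ (2 * c) = (1 + q) / 2"
    using c_pos q by (auto simp: \<kappa>_def)
  obtain t where t: "t > 1" "\<forall>p. 0 \<le> p \<and> p \<le> 1 \<and> (1 - p) * growth \<le> \<kappa> ^ (2 * c) \<longrightarrow>
      (\<lambda>(i, U). weight p (i, U) * t ^ (card U + i + 1)) summable_on first_sep"
    by (rule summable_weight[OF \<kappa>(1,2)])
  \<comment> \<open>Chosen so that the loss in \<open>weight_complex_bound\<close> is exactly the
    factor \<open>t\<close> allowed by \<open>summable_weight\<close>.\<close>
  define \<epsilon> where "\<epsilon> = root (\<Delta> + 1) t - 1"
  have \<epsilon>: "0 < \<epsilon>" "(1 + \<epsilon>) ^ (\<Delta> + 1) = t"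
    using t by (auto simp: \<epsilon>_def simp del: power_Suc)
  \<comment> \<open>The first bound keeps \<open>(1 - p) * growth\<close> below
    \<open>\<kappa> ^ (2 * c)\<close>; the second is equivalent to
    \<open>x + \<eta> \<le> (x - \<eta>) * (1 + \<epsilon>)\<close>.\<close>
  define \<eta> where "\<eta> = min ((1 - q) / 2 / growth) (\<epsilon> * x / (2 + \<epsilon>))"
  have \<eta>: "0 < \<eta>" "\<eta> * growth \<le> (1 - q) / 2" "\<eta> * (2 + \<epsilon>) \<le> \<epsilon> * x"
  proof -
    have "0 < (1 - q) / 2 / growth"
      by (rule divide_pos_pos[OF _ g(1)]) (use q(2) in simp)
    moreover have "0 < \<epsilon> * x / (2 + \<epsilon>)"
      using x0 \<epsilon>(1) by (intro divide_pos_pos mult_pos_pos) auto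
    ultimately show "0 < \<eta>" by (simp add: \<eta>_def)
    have "\<eta> \<le> (1 - q) / 2 / growth" "\<eta> \<le> \<epsilon> * x / (2 + \<epsilon>)" by (auto simp: \<eta>_def)
    then show "\<eta> * growth \<le> (1 - q) / 2" "\<eta> * (2 + \<epsilon>) \<le> \<epsilon> * x"
      using g(1) \<epsilon>(1) by (simp_all add: pos_le_divide_eq)
  qed
  \<comment> \<open>As \<open>1 - p = 1 - x + \<eta>\<close>, this dominates
    \<open>norm (1 - z)\<close> on the whole disc, even around \<open>x = 1\<close>, where
    comparison with \<open>x\<close> itself would fail.\<close>
  define p where "p = x - \<eta>"
  have "\<eta> * (2 + \<epsilon>) \<le> x * (2 + \<epsilon>)" using \<eta>(3) x0 by (simp add: algebra_simps)
  then have "\<eta> \<le> x" using \<epsilon> by simp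
  then have p: "0 \<le> p" "p \<le> 1" using x \<eta> by (auto simp: p_def)
  have "(1 - p) * growth = (1 - x) * growth + \<eta> * growth" by (simp add: p_def algebra_simps)
  also have "\<dots> \<le> q + (1 - q) / 2" using q \<eta> by linarith
  also have "\<dots> = \<kappa> ^ (2 * c)" using \<kappa> by (simp add: field_simps)
  finally have summable: "(\<lambda>(i, U). weight p (i, U) * t ^ (card U + i + 1)) summable_on first_sep"
    using p t(2) by simp
  have bound: "norm (weight z y) \<le> (\<lambda>(i, U). weight p (i, U) * t ^ (card U + i + 1)) y"
    if "y \<in> first_sep" "z \<in> cball (complex_of_real x) \<eta>" for y z
  proof -
    have z: "norm (z - of_real x) \<le> \<eta>" using that by (simp add: dist_norm norm_minus_commute)
    have "norm z \<le> norm (of_real x :: complex) + norm (z - of_real x)"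
      by (metis norm_triangle_sub)
    also have "\<dots> \<le> x + \<eta>" using z x0 by simp
    also have "\<dots> \<le> p * (1 + \<epsilon>)" using \<eta>(3) by (simp add: p_def algebra_simps)
    finally have 1: "norm z \<le> p * (1 + \<epsilon>)" .
    have "norm (1 - z) = norm (of_real (1 - x) - (z - of_real x))" by simp
    also have "\<dots> \<le> norm (of_real (1 - x) :: complex) + norm (z - of_real x)"
      by (rule norm_triangle_ineq4)
    also have "norm (of_real (1 - x) :: complex) = 1 - x"
      unfolding norm_of_real using x by simp
    also have "1 - x + norm (z - of_real x) \<le> (1 - p) * 1" using z by (simp add: p_def)
    also have "\<dots> \<le> (1 - p) * (1 + \<epsilon>)" using p \<epsilon> by (intro mult_left_mono) auto
    finally have 2: "norm (1 - z) \<le> (1 - p) * (1 + \<epsilon>)" .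
    show ?thesis
      using weight_complex_bound[OF _ 1 2, of "fst y" "snd y"] p \<epsilon> that(1) by (simp add: case_prod_beta)
  qed
  define G where "G z = (\<Sum>\<^sub>\<infinity>y\<in>first_sep. weight z y)" for z :: complex
  have "uniform_limit (cball (of_real x) \<eta>) (\<lambda>Y z. \<Sum>y\<in>Y. weight z y) G (finite_subsets_at_top first_sep)"
    unfolding G_def using bound summable by (rule Weierstrass_m_test_general)
  then have "G holomorphic_on ball (of_real x) \<eta>"
  proof (rule holomorphic_uniform_limit[rotated])
    show "\<forall>\<^sub>F Y in finite_subsets_at_top first_sep. continuous_on (cball (complex_of_real x) \<eta>) (\<lambda>z. \<Sum>y\<in>Y. weight z y)
        \<and> (\<lambda>z. \<Sum>y\<in>Y. weight z y) holomorphic_on ball (complex_of_real x) \<eta>"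
    proof -
      have "(\<lambda>z. \<Sum>y\<in>Y. weight z y) holomorphic_on X" for Y and X :: "complex set"
        by (intro holomorphic_on_sum weight_holomorphic)
      then show ?thesis
        by (intro always_eventually allI conjI holomorphic_on_imp_continuous_on)
    qed
  qed auto
  moreover have "G (of_real y) = of_real (measure (percolation E y) sep_event)"
    if "y \<in> {1 - 1 / growth<..1}" for y
  proof -
    have "0 \<le> y" using that \<open>0 \<le> 1 - 1 / growth\<close> unfolding greaterThanAtMost_iff by linarith
    moreover have "(1 - y) * growth < 1" using that g by (simp add: field_simps)
    ultimately have "(weight y has_sum measure (percolation E y) sep_event) first_sep"
      using that sep by (intro has_sum_sep_event) auto
    then have "(weight (complex_of_real y) has_sum of_real (measure (percolation E y) sep_event)) first_sep"
      unfolding weight_of_real by (rule has_sum_of_real)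
    then show ?thesis unfolding G_def by (rule infsumI)
  qed
  ultimately show "\<exists>r>0. \<exists>g. g holomorphic_on ball (complex_of_real x) r \<and>
        (\<forall>y\<in>{1 - 1 / growth<..1}. complex_of_real y \<in> ball (complex_of_real x) r \<longrightarrow>
           g (complex_of_real y) = complex_of_real (measure (percolation E y) sep_event))"
    using \<eta>(1) by blast
qed

end

section \<open>Geodesic rays, ends and line graphs\<close>

definition adj :: "'v set set \<Rightarrow> ('v \<times> 'v) set" where
  "adj E = {(x, y). {x, y} \<in> E}"

text \<open>Informative only for vertices joined by a walk.\<close>

definition gdist :: "'v set set \<Rightarrow> 'v \<Rightarrow> 'v \<Rightarrow> nat" where
  "gdist E x y = (LEAST n. (x, y) \<in> adj E ^^ n)"

lemma adj_commute: "(x, y) \<in> adj E \<longleftrightarrow> (y, x) \<in> adj E"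
  by (simp add: adj_def insert_commute)

lemma adj_relpow_commute: "(x, y) \<in> adj E ^^ n \<Longrightarrow> (y, x) \<in> adj E ^^ n"
proof (induction n arbitrary: y)
  case (Suc n)
  then obtain z where "(x, z) \<in> adj E ^^ n" "(z, y) \<in> adj E" by auto
  then have "(z, x) \<in> adj E ^^ n" "(y, z) \<in> adj E" using Suc.IH adj_commute by metis+
  then show ?case by (rule relpow_Suc_I2[rotated])
qed auto

lemma relpow_trans: "(x, y) \<in> r ^^ m \<Longrightarrow> (y, z) \<in> r ^^ n \<Longrightarrow> (x, z) \<in> r ^^ (m + n)"
  by (auto simp: relpow_add)

lemma gdist_le: "(x, y) \<in> adj E ^^ n \<Longrightarrow> gdist E x y \<le> n"
  unfolding gdist_def by (rule Least_le)

lemma gdist_relpow: "(x, y) \<in> (adj E)\<^sup>* \<Longrightarrow> (x, y) \<in> adj E ^^ gdist E x y"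
  unfolding gdist_def by (metis LeastI rtrancl_imp_relpow)

lemma gdist_step:
  assumes "(v, x) \<in> (adj E)\<^sup>*" "(x, y) \<in> adj E ^^ n"
  shows "gdist E v y \<le> gdist E v x + n"
  using gdist_relpow[OF assms(1)] assms(2) by (intro gdist_le relpow_trans)

text \<open>Koenig's lemma for the relation ``some geodesic from \<open>v\<close> to \<open>w\<close> passes through \<open>x\<close>''.\<close>

lemma geodesic_ray:
  assumes fin: "\<And>x. finite {y. {x, y} \<in> E}"
    and inf: "infinite {w. (v, w) \<in> (adj E)\<^sup>*}"
  obtains f where "f 0 = v" "\<And>n. {f n, f (Suc n)} \<in> E" "\<And>n. gdist E v (f n) = n"
proof -
  define beyond where "beyond x = {w. \<exists>k. (x, w) \<in> adj E ^^ k \<and> gdist E v w = gdist E v x + k}" for x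
  define P where "P n x \<longleftrightarrow> (n = 0 \<longrightarrow> x = v) \<and> (v, x) \<in> (adj E)\<^sup>* \<and> gdist E v x = n \<and> infinite (beyond x)" for n :: nat and x
  have vv: "gdist E v v = 0" using gdist_le[where E=E and x=v and y=v and n=0] by simp
  have "{w. (v, w) \<in> (adj E)\<^sup>*} \<subseteq> beyond v"
    using gdist_relpow[where E=E and x=v] vv by (auto simp: beyond_def)
  then have "infinite (beyond v)" using inf finite_subset by blast
  then have base: "P 0 v" using vv by (simp add: P_def)
  have step: "\<exists>y. P (Suc n) y \<and> (x, y) \<in> adj E" if P: "P n x" for n x
  proof -
    have x: "(v, x) \<in> (adj E)\<^sup>*" "gdist E v x = n" "infinite (beyond x)" using P by (auto simp: P_def)
    define N where "N = {y. {x, y} \<in> E \<and> gdist E v y = Suc n}"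
    have "finite N" using fin[of x] by (auto simp: N_def)
    have "beyond x \<subseteq> insert x (\<Union>y\<in>N. beyond y)"
    proof
      fix w assume "w \<in> beyond x"
      then obtain k where k: "(x, w) \<in> adj E ^^ k" "gdist E v w = n + k"
        using x by (auto simp: beyond_def)
      show "w \<in> insert x (\<Union>y\<in>N. beyond y)"
      proof (cases k)
        case 0
        then show ?thesis using k by auto
      next
        case (Suc k')
        then obtain y where y: "(x, y) \<in> adj E" "(y, w) \<in> adj E ^^ k'"
          using k(1) relpow_Suc_D2 by metis
        have vy: "(v, y) \<in> (adj E)\<^sup>*" using x(1) y(1) by auto
        \<comment> \<open>The second vertex of the walk lies exactly one layer further out: a
          smaller distance would bring \<open>w\<close> closer to \<open>v\<close> than
          \<open>n + k\<close>.\<close>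
        have "gdist E v y \<le> n + 1" using gdist_step[OF x(1), of y 1] y x by simp
        moreover have "gdist E v w \<le> gdist E v y + k'" using vy y(2) by (rule gdist_step)
        ultimately have "gdist E v y = Suc n" using k(2) Suc by simp
        then show ?thesis
          using y k(2) Suc by (auto simp: N_def beyond_def adj_def)
      qed
    qed
    then have "\<exists>y\<in>N. infinite (beyond y)"
      using x(3) \<open>finite N\<close> by (meson finite_UN finite_insert finite_subset)
    then obtain y where "y \<in> N" "infinite (beyond y)" by auto
    then show ?thesis
      using x(1) by (intro exI[of _ y]) (auto simp: N_def P_def adj_def intro: rtrancl_into_rtrancl)
  qed
  obtain f where f: "\<And>n. P n (f n)" "\<And>n. (f n, f (Suc n)) \<in> adj E"
    using dependent_nat_choice[of P "\<lambda>n x y. (x, y) \<in> adj E"] base step by metis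
  show ?thesis
  proof (rule that)
    show "f 0 = v" "\<And>n. gdist E v (f n) = n" using f(1) by (auto simp: P_def)
    show "\<And>n. {f n, f (Suc n)} \<in> E" using f(2) by (auto simp: adj_def)
  qed
qed

lemma inj_geodesic: "(\<And>n. gdist E v (f n) = n) \<Longrightarrow> inj f"
  by (metis injI)

lemma walk_relpow:
  assumes "\<And>n. {f n, f (Suc n)} \<in> E"
  shows "i \<le> j \<Longrightarrow> (f i, f j) \<in> adj E ^^ (j - i)"
proof (induction "j - i" arbitrary: j)
  case (Suc k)
  then obtain j' where j': "j = Suc j'" "i \<le> j'" "k = j' - i" by (cases j) auto
  then have "(f i, f j') \<in> adj E ^^ (j' - i)" using Suc by auto
  moreover have "(f j', f j) \<in> adj E" using assms j' by (simp add: adj_def)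
  ultimately have "(f i, f j) \<in> adj E ^^ Suc (j' - i)" by auto
  then show ?case using j' Suc_diff_le by metis
qed auto

text \<open>An injective sequence leaves a finite set for good. Besides giving a component for the
  tail, this is the reflexivity of \<open>ray_rel\<close>.\<close>

lemma ray_tail:
  assumes g: "g \<in> rays E" and "finite X"
  shows "\<exists>N. \<forall>i\<ge>N. \<forall>j\<ge>N. same_component_avoiding E X (g i) (g j)"
proof -
  have inj: "inj g" and edges: "\<And>n. {g n, g (Suc n)} \<in> E" using g by (auto simp: rays_def)
  have "finite (g -` X)" using finite_vimageI[OF \<open>finite X\<close> inj] .
  then obtain N where N: "\<And>n. n \<ge> N \<Longrightarrow> g n \<notin> X"
    by (metis finite_nat_set_iff_bounded_le vimageI not_less_eq_eq)
  let ?r = "{(x, y). {x, y} \<in> E \<and> x \<notin> X \<and> y \<notin> X}"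
  have up: "(g i, g (i + k)) \<in> ?r\<^sup>* \<and> (g (i + k), g i) \<in> ?r\<^sup>*" if "N \<le> i" for i k
  proof (induction k)
    case (Suc k)
    have "(g (i + k), g (i + Suc k)) \<in> ?r" "(g (i + Suc k), g (i + k)) \<in> ?r"
      using edges[of "i + k"] N that by (auto simp: insert_commute)
    then show ?case using Suc
      by (meson converse_rtrancl_into_rtrancl rtrancl.rtrancl_into_rtrancl)
  qed auto
  have "same_component_avoiding E X (g i) (g j)" if "N \<le> i" "N \<le> j" for i j
    using up[OF that(1), of "j - i"] up[OF that(2), of "i - j"] that N
    by (cases "i \<le> j") (auto simp: same_component_avoiding_def)
  then show ?thesis by blast
qed

lemma one_ended_rays:
  assumes "one_ended E" and f: "f \<in> rays E" and g: "g \<in> rays E" and "finite X"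
  shows "\<exists>N. \<forall>i\<ge>N. \<forall>j\<ge>N. same_component_avoiding E X (f i) (g j)"
proof -
  have "\<exists>A. ends E = {A}"
    using assms(1) by (simp add: one_ended_def card_1_singleton_iff)
  moreover have "ray_rel E `` {f} \<in> ends E" "ray_rel E `` {g} \<in> ends E"
    using f g by (auto simp: ends_def quotientI)
  ultimately have "ray_rel E `` {f} = ray_rel E `` {g}" by auto
  moreover have "(g, g) \<in> ray_rel E"
    using g ray_tail by (auto simp: ray_rel_def)
  ultimately have "(f, g) \<in> ray_rel E" by blast
  then show ?thesis using \<open>finite X\<close> by (auto simp: ray_rel_def)
qed

text \<open>Every edge is related to itself, so \<open>line E ^^ n\<close> describes balls of radius
  \<open>n\<close> rather than walks of exact length.\<close>

definition line :: "'v set set \<Rightarrow> ('v set \<times> 'v set) set" where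
  "line E = {(e, f). e \<in> E \<and> f \<in> E \<and> e \<inter> f \<noteq> {}}"

section \<open>Balls in the line graph of a regular graph\<close>

locale simple_graph =
  fixes E :: "'v set set"
  assumes edge_card: "\<And>e. e \<in> E \<Longrightarrow> card e = 2"
begin

lemma edge_cases:
  assumes "e \<in> E" "x \<in> e"
  obtains y where "e = {x, y}" "x \<noteq> y"
  using edge_card[OF assms(1)] assms(2) by (auto simp: card_2_iff)

lemma line_refl: "e \<in> E \<Longrightarrow> (e, e) \<in> line E"
  using edge_card[of e] by (auto simp: line_def)

lemma line_commute: "(e, f) \<in> line E \<Longrightarrow> (f, e) \<in> line E"
  by (auto simp: line_def)

lemma line_relpow_commute: "(x, y) \<in> line E ^^ n \<Longrightarrow> (y, x) \<in> line E ^^ n"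
proof (induction n arbitrary: y)
  case (Suc n)
  then obtain z where "(x, z) \<in> line E ^^ n" "(z, y) \<in> line E" by auto
  then have "(z, x) \<in> line E ^^ n" "(y, z) \<in> line E" using Suc.IH line_commute by blast+
  then show ?case by (rule relpow_Suc_I2[rotated])
qed auto

lemma line_relpow_E: "(e, f) \<in> line E ^^ n \<Longrightarrow> e \<in> E \<longleftrightarrow> f \<in> E"
  by (induction n arbitrary: f) (auto simp: line_def)

lemma line_relpow_mono:
  assumes "(e, f) \<in> line E ^^ m" "m \<le> n" "e \<in> E"
  shows "(e, f) \<in> line E ^^ n"
proof -
  have "(f, f) \<in> line E ^^ k" for k
    using line_refl line_relpow_E[OF assms(1)] assms(3) by (induction k) auto
  then have "(e, f) \<in> line E ^^ (m + (n - m))" using assms(1) relpow_trans by metis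
  then show ?thesis using assms(2) by simp
qed

lemma line_relpow_dist:
  assumes "(e, f) \<in> line E ^^ n" "x \<in> e" "y \<in> f" "e \<in> E"
  shows "\<exists>k\<le>n + 1. (x, y) \<in> adj E ^^ k"
  using assms
proof (induction n arbitrary: f y)
  case 0
  then have "{x, y} \<in> E \<or> x = y" by (auto elim: edge_cases)
  then show ?case
    by (metis (mono_tags, lifting) adj_def add_0 case_prodI mem_Collect_eq le_refl zero_le relpow_0_I relpow_1 One_nat_def)
next
  case (Suc n)
  then obtain f' where f': "(e, f') \<in> line E ^^ n" "(f', f) \<in> line E" by auto
  then obtain z where z: "z \<in> f'" "z \<in> f" "f \<in> E" by (auto simp: line_def)
  obtain k where k: "k \<le> n + 1" "(x, z) \<in> adj E ^^ k"
    using Suc.IH[OF f'(1) _ z(1)] Suc.prems by auto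
  have "z = y \<or> (z, y) \<in> adj E" using z Suc.prems by (auto simp: adj_def elim: edge_cases)
  then show ?case
  proof
    assume "(z, y) \<in> adj E"
    then have "(x, y) \<in> adj E ^^ Suc k" using k by auto
    then show ?thesis using k by (intro exI[of _ "Suc k"]) auto
  next
    assume "z = y"
    then show ?thesis using k by (intro exI[of _ k]) auto
  qed
qed

end

locale regular_graph = simple_graph +
  fixes V and d :: nat
  assumes edges_V: "\<And>e. e \<in> E \<Longrightarrow> e \<subseteq> V"
    and finite_incident: "\<And>x. x \<in> V \<Longrightarrow> finite {e \<in> E. x \<in> e}"
    and degree: "\<And>x. x \<in> V \<Longrightarrow> vertex_degree E x = d"
begin

lemma finite_nbr: "finite {y. {x, y} \<in> E}"
proof (cases "x \<in> V")
  case True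
  have "{y. {x, y} \<in> E} \<subseteq> \<Union> {e \<in> E. x \<in> e}" by auto
  moreover have "finite (\<Union> {e \<in> E. x \<in> e})"
    using finite_incident[OF True] edge_card by (intro finite_Union) (auto intro: card_ge_0_finite)
  ultimately show ?thesis by (rule finite_subset)
next
  case False
  then have "{y. {x, y} \<in> E} = {}" using edges_V by auto
  then show ?thesis by (simp only: finite.emptyI)
qed

lemma line_nbrs:
  assumes "e \<in> E"
  shows "finite (line E `` {e})" "card (line E `` {e} - {e}) \<le> 2 * d - 2"
proof -
  obtain u w where uw: "e = {u, w}" "u \<noteq> w"
    using edge_card[OF assms] by (auto simp: card_2_iff)
  let ?I = "\<lambda>x. {f \<in> E. x \<in> f}"
  have V: "u \<in> V" "w \<in> V" using edges_V[OF assms] uw by auto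
  have fin: "finite (?I u)" "finite (?I w)" using V finite_incident by auto
  have sub: "line E `` {e} \<subseteq> ?I u \<union> ?I w" using uw by (auto simp: line_def)
  show "finite (line E `` {e})" by (rule finite_subset[OF sub]) (use fin in auto)
  have "card (line E `` {e} - {e}) \<le> card ((?I u - {e}) \<union> (?I w - {e}))"
    using sub fin by (intro card_mono) auto
  also have "\<dots> \<le> card (?I u - {e}) + card (?I w - {e})" by (rule card_Un_le)
  also have "\<dots> = (d - 1) + (d - 1)"
    using assms uw degree[OF V(1)] degree[OF V(2)] fin by (simp add: card_Diff_singleton vertex_degree_def)
  finally show "card (line E `` {e} - {e}) \<le> 2 * d - 2" by simp
qed

lemma line_relpow_first_step:
  assumes "(e, g) \<in> line E ^^ Suc k" "g \<noteq> e"
  shows "\<exists>f. f \<noteq> e \<and> (e, f) \<in> line E \<and> (f, g) \<in> line E ^^ k"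
  using assms(1)
proof (induction k)
  case 0
  then show ?case using assms(2) by auto
next
  case (Suc k)
  obtain f where f: "(e, f) \<in> line E" "(f, g) \<in> line E ^^ Suc k"
    using Suc.prems relpow_Suc_D2 by metis
  show ?case
  proof (cases "f = e")
    case True
    then obtain f' where f': "f' \<noteq> e" "(e, f') \<in> line E" "(f', g) \<in> line E ^^ k"
      using Suc.IH f(2) by auto
    have "(f', g) \<in> line E ^^ Suc k"
      by (rule line_relpow_mono[OF f'(3)]) (use f' in \<open>auto simp: line_def\<close>)
    then show ?thesis using f' by blast
  qed (use f in blast)
qed

text \<open>Removing the centre makes the bound a pure power instead of a geometric sum. Any other
  edge of the larger ball lies in a smaller ball around a neighbour \<open>f\<close> of
  \<open>e\<close>; that ball contains both \<open>e\<close> and \<open>f\<close>, so discarding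
  \<open>e\<close> instead of \<open>f\<close> leaves the same number. As this needs radius at least
  1, the induction starts there.\<close>

lemma card_line_ball:
  assumes "e \<in> E"
  shows "finite ((line E ^^ k) `` {e}) \<and> card ((line E ^^ k) `` {e} - {e}) \<le> (2 * d - 2) ^ k"
proof (cases k)
  case 0
  then show ?thesis by simp
next
  case (Suc k)
  have "finite ((line E ^^ Suc k) `` {e}) \<and> card ((line E ^^ Suc k) `` {e} - {e}) \<le> (2 * d - 2) ^ Suc k"
    using assms
  proof (induction k arbitrary: e)
    case 0
    then show ?case using line_nbrs by simp
  next
    case (Suc k)
    let ?B = "\<lambda>f. (line E ^^ Suc k) `` {f}"
    let ?N = "line E `` {e} - {e}"
    have N_E: "f \<in> E" if "f \<in> ?N" for f using that by (auto simp: line_def)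
    have sub: "(line E ^^ Suc (Suc k)) `` {e} - {e} \<subseteq> (\<Union>f\<in>?N. ?B f - {e})"
      using line_relpow_first_step[of e _ "Suc k"] by blast
    have fin: "finite (\<Union>f\<in>?N. ?B f - {e})"
      using line_nbrs(1)[OF Suc.prems] Suc.IH N_E by blast
    have card: "card (?B f - {e}) \<le> (2 * d - 2) ^ Suc k" if f: "f \<in> ?N" for f
    proof -
      have fE: "f \<in> E" using f by (rule N_E)
      have "(f, e) \<in> line E ^^ 1" using f line_commute by simp
      then have "e \<in> ?B f" using line_relpow_mono[OF _ _ fE, of e 1 "Suc k"] by auto
      moreover have "f \<in> ?B f"
        using line_relpow_mono[OF _ _ fE, of f 0 "Suc k"] by auto
      ultimately have "card (?B f - {e}) = card (?B f - {f})"
        using Suc.IH[OF fE] by (simp add: card_Diff_singleton)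
      then show ?thesis using Suc.IH[OF fE] by simp
    qed
    have "card ((line E ^^ Suc (Suc k)) `` {e} - {e}) \<le> card (\<Union>f\<in>?N. ?B f - {e})"
      using sub fin by (rule card_mono[rotated])
    also have "\<dots> \<le> (\<Sum>f\<in>?N. card (?B f - {e}))"
      using line_nbrs(1)[OF Suc.prems] by (intro card_UN_le) auto
    also have "\<dots> \<le> (\<Sum>f\<in>?N. (2 * d - 2) ^ Suc k)"
      using card by (rule sum_mono)
    also have "\<dots> \<le> (2 * d - 2) * (2 * d - 2) ^ Suc k"
      using line_nbrs(2)[OF Suc.prems] by simp
    finally have "card ((line E ^^ Suc (Suc k)) `` {e} - {e}) \<le> (2 * d - 2) ^ Suc (Suc k)"
      by simp
    moreover have "finite ((line E ^^ Suc (Suc k)) `` {e})"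
      using finite_subset[OF sub fin] by (simp only: finite_Diff_insert Diff_empty)
    ultimately show ?case by simp
  qed
  then show ?thesis using Suc by simp
qed

end

section \<open>Cuts of Cayley graphs\<close>

locale cayley_presentation =
  fixes S :: "'a set" and R :: "'a gword set"
  assumes finite_S: "finite S" and finite_R: "finite R" and R_words: "R \<subseteq> words S"
    and relator_cycles: "relators_induce_cycles S R"
    and infinite_group: "infinite (carrier (presented_group S R))"
begin

abbreviation "Gp \<equiv> presented_group S R"
abbreviation "V \<equiv> carrier Gp"
abbreviation "E \<equiv> cayley_graph S R"
abbreviation "cl \<equiv> word_class S R"
abbreviation "letters \<equiv> S \<times> (UNIV :: bool set)"

sublocale P: group Gp
  by (rule group_presented_group)

lemma Cons_words: "x # w \<in> words S \<longleftrightarrow> x \<in> letters \<and> w \<in> words S"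
  by (auto simp: words_def)

lemma cl_closed: "w \<in> words S \<Longrightarrow> cl w \<in> V"
  by (rule word_class_in_carrier)

lemma cl_letter: "x \<in> letters \<Longrightarrow> cl [x] \<in> V"
  by (rule cl_closed) (simp add: words_def)

lemma cl_nil: "cl [] = \<one>\<^bsub>Gp\<^esub>"
  by (simp add: one_presented_group)

lemma cl_append: "u \<in> words S \<Longrightarrow> v \<in> words S \<Longrightarrow> cl (u @ v) = cl u \<otimes>\<^bsub>Gp\<^esub> cl v"
  by (simp add: mult_word_class)

lemma cl_Cons: "x \<in> letters \<Longrightarrow> w \<in> words S \<Longrightarrow> cl (x # w) = cl [x] \<otimes>\<^bsub>Gp\<^esub> cl w"
  using cl_append[of "[x]" w] by (simp add: words_def)

lemma cl_pres_eq: "pres_eq S R u v \<Longrightarrow> cl u = cl v"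
  using pres_eq_words word_class_eq_iff by metis

lemma cl_inverse_letters: "s \<in> S \<Longrightarrow> cl [(s, b)] \<otimes>\<^bsub>Gp\<^esub> cl [(s, \<not> b)] = \<one>\<^bsub>Gp\<^esub>"
  using cl_pres_eq[OF pres_eq.cancel[of "[]" S "[]" s R b]] cl_append[of "[(s, b)]" "[(s, \<not> b)]"]
  by (simp add: words_def cl_nil)

lemma cl_relator: "r \<in> R \<Longrightarrow> cl r = \<one>\<^bsub>Gp\<^esub>"
  using cl_pres_eq[OF pres_eq.relator[of "[]" S "[]" r R]] R_words
  by (auto simp: words_def cl_nil)

lemma VE: "g \<in> V \<Longrightarrow> \<exists>u\<in>words S. g = cl u"
  by (metis carrier_presented_groupE)

lemma mult_letter_cancel:
  assumes "g \<in> V" "s \<in> S"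
  shows "(g \<otimes>\<^bsub>Gp\<^esub> cl [(s, b)]) \<otimes>\<^bsub>Gp\<^esub> cl [(s, \<not> b)] = g"
  using assms by (simp add: P.m_assoc cl_letter cl_inverse_letters)

lemma edges_eq: "E = {{g, g \<otimes>\<^bsub>Gp\<^esub> cl [(s, True)]} | g s. g \<in> V \<and> s \<in> S \<and> cl [(s, True)] \<noteq> \<one>\<^bsub>Gp\<^esub>}"
  by (auto simp: cayley_graph_def cayley_edges_def)

lemma edgeI:
  "g \<in> V \<Longrightarrow> s \<in> S \<Longrightarrow> cl [(s, True)] \<noteq> \<one>\<^bsub>Gp\<^esub> \<Longrightarrow> {g, g \<otimes>\<^bsub>Gp\<^esub> cl [(s, True)]} \<in> E"
  unfolding edges_eq mem_Collect_eq by (intro exI conjI) (rule HOL.refl)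

lemma edgeE:
  assumes "e \<in> E"
  obtains g s where "g \<in> V" "s \<in> S" "e = {g, g \<otimes>\<^bsub>Gp\<^esub> cl [(s, True)]}" "cl [(s, True)] \<noteq> \<one>\<^bsub>Gp\<^esub>"
  using assms unfolding edges_eq by blast

lemma mult_eq_self: "g \<in> V \<Longrightarrow> h \<in> V \<Longrightarrow> g \<otimes>\<^bsub>Gp\<^esub> h = g \<longleftrightarrow> h = \<one>\<^bsub>Gp\<^esub>"
  by (metis P.l_cancel_one)

lemma letter_edge:
  assumes g: "g \<in> V" and x: "x \<in> letters"
  shows "{g, g \<otimes>\<^bsub>Gp\<^esub> cl [x]} \<in> E \<or> g \<otimes>\<^bsub>Gp\<^esub> cl [x] = g"
proof (cases "g \<otimes>\<^bsub>Gp\<^esub> cl [x] = g")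
  case False
  obtain s b where sb: "x = (s, b)" "s \<in> S" using x by auto
  show ?thesis
  proof (cases b)
    case True
    then have "cl [(s, True)] \<noteq> \<one>\<^bsub>Gp\<^esub>" using False sb g by auto
    then show ?thesis using edgeI[OF g sb(2)] sb True by simp
  next
    case b: False
    let ?h = "g \<otimes>\<^bsub>Gp\<^esub> cl [x]"
    have h: "?h \<in> V" using g x by (simp add: cl_letter)
    have ret: "?h \<otimes>\<^bsub>Gp\<^esub> cl [(s, True)] = g"
      using mult_letter_cancel[OF g sb(2), of False] sb b by simp
    have "cl [(s, True)] \<noteq> \<one>\<^bsub>Gp\<^esub>" using ret h False by auto
    then have "{?h, ?h \<otimes>\<^bsub>Gp\<^esub> cl [(s, True)]} \<in> E" by (rule edgeI[OF h sb(2)])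
    then show ?thesis using ret by (simp add: insert_commute)
  qed
qed simp

lemma edges_sub: "e \<in> E \<Longrightarrow> e \<subseteq> V"
  by (elim edgeE) (auto simp: cl_letter)

lemma edge_two: "e \<in> E \<Longrightarrow> card e = 2"
proof (elim edgeE)
  fix g s assume *: "g \<in> V" "s \<in> S" "e = {g, g \<otimes>\<^bsub>Gp\<^esub> cl [(s, True)]}" "cl [(s, True)] \<noteq> \<one>\<^bsub>Gp\<^esub>"
  then have "g \<otimes>\<^bsub>Gp\<^esub> cl [(s, True)] \<noteq> g" by (simp add: mult_eq_self cl_letter)
  then show "card e = 2" using * by (auto simp: card_2_iff)
qed

text \<open>Generators act from the right, so left multiplication is an automorphism of the graph.
  It yields regularity and moves geodesics to any vertex.\<close>

definition translate :: "'a gword set \<Rightarrow> 'a gword set set \<Rightarrow> 'a gword set set" where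
  "translate h e = (\<lambda>g. h \<otimes>\<^bsub>Gp\<^esub> g) ` e"

lemma translate_edge: "h \<in> V \<Longrightarrow> e \<in> E \<Longrightarrow> translate h e \<in> E"
proof (elim edgeE)
  fix g s assume *: "h \<in> V" "g \<in> V" "s \<in> S" "e = {g, g \<otimes>\<^bsub>Gp\<^esub> cl [(s, True)]}" "cl [(s, True)] \<noteq> \<one>\<^bsub>Gp\<^esub>"
  then have "translate h e = {h \<otimes>\<^bsub>Gp\<^esub> g, (h \<otimes>\<^bsub>Gp\<^esub> g) \<otimes>\<^bsub>Gp\<^esub> cl [(s, True)]}"
    by (simp add: translate_def P.m_assoc cl_letter)
  moreover have "h \<otimes>\<^bsub>Gp\<^esub> g \<in> V" using * by simp
  ultimately show "translate h e \<in> E" using * edgeI by simp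
qed

lemma translate_inv: "h \<in> V \<Longrightarrow> e \<subseteq> V \<Longrightarrow> translate (inv\<^bsub>Gp\<^esub> h) (translate h e) = e"
proof -
  assume h: "h \<in> V" and e: "e \<subseteq> V"
  have "translate (inv\<^bsub>Gp\<^esub> h) (translate h e) = (\<lambda>g. inv\<^bsub>Gp\<^esub> h \<otimes>\<^bsub>Gp\<^esub> (h \<otimes>\<^bsub>Gp\<^esub> g)) ` e"
    by (auto simp: translate_def)
  also have "\<dots> = (\<lambda>g. g) ` e"
    using h e by (intro image_cong HOL.refl) (auto simp: P.m_assoc[symmetric])
  finally show ?thesis by simp
qed

lemma translate_adj: "h \<in> V \<Longrightarrow> (x, y) \<in> adj E \<Longrightarrow> (h \<otimes>\<^bsub>Gp\<^esub> x, h \<otimes>\<^bsub>Gp\<^esub> y) \<in> adj E"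
  using translate_edge[of h "{x, y}"] by (simp add: adj_def translate_def)

lemma translate_relpow:
  "h \<in> V \<Longrightarrow> (x, y) \<in> adj E ^^ n \<Longrightarrow> (h \<otimes>\<^bsub>Gp\<^esub> x, h \<otimes>\<^bsub>Gp\<^esub> y) \<in> adj E ^^ n"
proof (induction n arbitrary: y)
  case (Suc n)
  then obtain z where "(x, z) \<in> adj E ^^ n" "(z, y) \<in> adj E" by auto
  then have "(h \<otimes>\<^bsub>Gp\<^esub> x, h \<otimes>\<^bsub>Gp\<^esub> z) \<in> adj E ^^ n" "(h \<otimes>\<^bsub>Gp\<^esub> z, h \<otimes>\<^bsub>Gp\<^esub> y) \<in> adj E"
    using Suc translate_adj by auto
  then show ?case by auto
qed auto

lemma incident_translate:
  assumes "g \<in> V"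
  shows "{e \<in> E. g \<in> e} = translate g ` {e \<in> E. \<one>\<^bsub>Gp\<^esub> \<in> e}"
proof
  show "translate g ` {e \<in> E. \<one>\<^bsub>Gp\<^esub> \<in> e} \<subseteq> {e \<in> E. g \<in> e}"
    using assms translate_edge by (force simp: translate_def)
  show "{e \<in> E. g \<in> e} \<subseteq> translate g ` {e \<in> E. \<one>\<^bsub>Gp\<^esub> \<in> e}"
  proof
    fix e assume e: "e \<in> {e \<in> E. g \<in> e}"
    let ?e = "translate (inv\<^bsub>Gp\<^esub> g) e"
    have "?e \<in> E" using e assms by (auto intro: translate_edge)
    moreover have "\<one>\<^bsub>Gp\<^esub> \<in> ?e" using e assms by (force simp: translate_def)
    moreover have "e = translate g ?e"
      using translate_inv[of "inv\<^bsub>Gp\<^esub> g" e] e assms edges_sub by auto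
    ultimately show "e \<in> translate g ` {e \<in> E. \<one>\<^bsub>Gp\<^esub> \<in> e}" by blast
  qed
qed

lemma inj_translate: "g \<in> V \<Longrightarrow> inj_on (translate g) E"
  by (rule inj_on_inverseI[where g = "translate (inv\<^bsub>Gp\<^esub> g)"]) (simp add: translate_inv edges_sub)

lemma finite_incident_one: "finite {e \<in> E. \<one>\<^bsub>Gp\<^esub> \<in> e}"
proof -
  let ?A = "(\<lambda>x. {\<one>\<^bsub>Gp\<^esub>, cl [x]}) ` letters"
  have "{e \<in> E. \<one>\<^bsub>Gp\<^esub> \<in> e} \<subseteq> ?A"
  proof
    fix e assume e: "e \<in> {e \<in> E. \<one>\<^bsub>Gp\<^esub> \<in> e}"
    then have "e \<in> E" by simp
    then obtain g s where *: "g \<in> V" "s \<in> S" "e = {g, g \<otimes>\<^bsub>Gp\<^esub> cl [(s, True)]}"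
      by (rule edgeE)
    show "e \<in> ?A"
    proof (cases "g = \<one>\<^bsub>Gp\<^esub>")
      case True
      then show ?thesis using * by (intro image_eqI[of _ _ "(s, True)"]) (auto simp: cl_letter)
    next
      case False
      then have eq: "g \<otimes>\<^bsub>Gp\<^esub> cl [(s, True)] = \<one>\<^bsub>Gp\<^esub>" using e * by auto
      have "g = cl [(s, False)]"
        using mult_letter_cancel[OF *(1,2), of True] *(2) unfolding eq by (simp add: cl_letter)
      then show ?thesis using * eq by (intro image_eqI[of _ _ "(s, False)"]) auto
    qed
  qed
  moreover have "finite ?A" using finite_S by simp
  ultimately show ?thesis by (rule finite_subset)
qed

abbreviation "deg \<equiv> vertex_degree E \<one>\<^bsub>Gp\<^esub>"

sublocale regular_graph E V deg
proof
  fix x assume "x \<in> V"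
  show "finite {e \<in> E. x \<in> e}"
    unfolding incident_translate[OF \<open>x \<in> V\<close>] using finite_incident_one by simp
  show "vertex_degree E x = deg"
    unfolding vertex_degree_def incident_translate[OF \<open>x \<in> V\<close>]
    by (rule card_image[OF inj_on_subset[OF inj_translate[OF \<open>x \<in> V\<close>]]]) auto
qed (use edge_two edges_sub in auto)

lemma adj_V: "(x, y) \<in> adj E \<Longrightarrow> x \<in> V \<and> y \<in> V"
  using edges_sub by (auto simp: adj_def)

lemma connected: "x \<in> V \<Longrightarrow> y \<in> V \<Longrightarrow> (x, y) \<in> (adj E)\<^sup>*"
proof -
  have *: "(g, g \<otimes>\<^bsub>Gp\<^esub> cl w) \<in> (adj E)\<^sup>*" if "g \<in> V" "w \<in> words S" for g w
    using that
  proof (induction w arbitrary: g)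
    case Nil
    then show ?case by (simp add: cl_nil)
  next
    case (Cons x w)
    have x: "x \<in> letters" and w: "w \<in> words S" using Cons.prems by (auto simp: Cons_words)
    let ?h = "g \<otimes>\<^bsub>Gp\<^esub> cl [x]"
    have h: "?h \<in> V" using Cons.prems x by (simp add: cl_letter)
    have "(g, ?h) \<in> adj E \<or> g = ?h" using letter_edge[OF Cons.prems(1) x] by (auto simp: adj_def)
    then have "(g, ?h \<otimes>\<^bsub>Gp\<^esub> cl w) \<in> (adj E)\<^sup>*"
      using Cons.IH[OF h w] by (auto intro: converse_rtrancl_into_rtrancl)
    then show ?case using Cons.prems x w by (simp add: cl_Cons P.m_assoc cl_letter cl_closed)
  qed
  assume xy: "x \<in> V" "y \<in> V"
  obtain w where "w \<in> words S" "inv\<^bsub>Gp\<^esub> x \<otimes>\<^bsub>Gp\<^esub> y = cl w" using xy VE by (metis P.inv_closed P.m_closed)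
  then have "x \<otimes>\<^bsub>Gp\<^esub> cl w = (x \<otimes>\<^bsub>Gp\<^esub> inv\<^bsub>Gp\<^esub> x) \<otimes>\<^bsub>Gp\<^esub> y"
    using xy by (simp only: P.m_assoc P.inv_closed)
  then show "(x, y) \<in> (adj E)\<^sup>*" using *[OF xy(1) \<open>w \<in> words S\<close>] xy by simp
qed

lemma countable_V: "countable V"
proof -
  have "countable (words S)"
    unfolding words_def using finite_S by (intro countable_lists countable_finite) auto
  moreover have "V \<subseteq> cl ` words S" using VE by auto
  ultimately show ?thesis by (meson countable_image countable_subset)
qed

lemma countable_edges: "countable E"
proof (rule countable_subset)
  show "E \<subseteq> {e. finite e \<and> e \<subseteq> V}"
    using edge_two edges_sub by (auto intro: card_ge_0_finite)
  show "countable {e. finite e \<and> e \<subseteq> V}" using countable_V by (rule countable_Collect_finite_subset)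
qed

lemma geodesic_ray_from:
  assumes "v \<in> V"
  obtains f where "f 0 = v" "\<And>n. {f n, f (Suc n)} \<in> E" "\<And>n. gdist E v (f n) = n"
proof -
  have "V \<subseteq> {w. (v, w) \<in> (adj E)\<^sup>*}" using connected assms by auto
  then have "infinite {w. (v, w) \<in> (adj E)\<^sup>*}" using infinite_group finite_subset by blast
  from geodesic_ray[OF finite_nbr this] that show ?thesis by blast
qed

text \<open>A geodesic ray from \<open>v\<close> is translated so that its \<open>M\<close>-th
  vertex becomes \<open>v\<close>. The last clause says that the walk is geodesic between any two of
  its vertices.\<close>

lemma two_sided_geodesic:
  assumes "v \<in> V"
  obtains y where "y M = v" "\<And>j. {y j, y (Suc j)} \<in> E"
    "\<And>j k n. j \<le> k \<Longrightarrow> (y j, y k) \<in> adj E ^^ n \<Longrightarrow> k \<le> j + n"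
proof -
  obtain f where f: "f 0 = v" "\<And>n. {f n, f (Suc n)} \<in> E" "\<And>n. gdist E v (f n) = n"
    using geodesic_ray_from[OF assms] by blast
  have fV: "f n \<in> V" for n using f(2)[of n] edges_sub by auto
  define h where "h = v \<otimes>\<^bsub>Gp\<^esub> inv\<^bsub>Gp\<^esub> (f M)"
  have h: "h \<in> V" using assms fV by (simp add: h_def)
  show ?thesis
  proof (rule that[of "\<lambda>j. h \<otimes>\<^bsub>Gp\<^esub> f j"])
    show "h \<otimes>\<^bsub>Gp\<^esub> f M = v" using assms fV by (simp add: h_def P.m_assoc)
    show "{h \<otimes>\<^bsub>Gp\<^esub> f j, h \<otimes>\<^bsub>Gp\<^esub> f (Suc j)} \<in> E" for j
      using translate_edge[OF h f(2)] by (simp add: translate_def)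
    fix j k n assume "j \<le> k" and 1: "(h \<otimes>\<^bsub>Gp\<^esub> f j, h \<otimes>\<^bsub>Gp\<^esub> f k) \<in> adj E ^^ n"
    have "(inv\<^bsub>Gp\<^esub> h \<otimes>\<^bsub>Gp\<^esub> (h \<otimes>\<^bsub>Gp\<^esub> f j), inv\<^bsub>Gp\<^esub> h \<otimes>\<^bsub>Gp\<^esub> (h \<otimes>\<^bsub>Gp\<^esub> f k)) \<in> adj E ^^ n"
      using translate_relpow[OF _ 1, of "inv\<^bsub>Gp\<^esub> h"] h by simp
    then have "(f j, f k) \<in> adj E ^^ n"
      using h fV by (simp add: P.m_assoc[symmetric])
    then have "gdist E v (f k) \<le> gdist E v (f j) + n"
      using connected assms fV by (intro gdist_step) auto
    then show "k \<le> j + n" by (simp add: f(3))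
  qed
qed

lemma deg_ge_2: "2 \<le> deg"
proof -
  obtain f where f: "\<And>n. {f n, f (Suc n)} \<in> E" "\<And>n. gdist E \<one>\<^bsub>Gp\<^esub> (f n) = n"
    using geodesic_ray_from[OF P.one_closed] by metis
  have V: "f 1 \<in> V" using f(1)[of 1] edges_sub by auto
  have "inj f" using f(2) by (rule inj_geodesic)
  then have "{f 0, f 1} \<noteq> {f 1, f 2}" by (auto simp: doubleton_eq_iff inj_eq)
  moreover have "{{f 0, f 1}, {f 1, f 2}} \<subseteq> {e \<in> E. f 1 \<in> e}"
    using f(1)[of 0] f(1)[of 1] by (auto simp: numeral_2_eq_2)
  then have "card {{f 0, f 1}, {f 1, f 2}} \<le> card {e \<in> E. f 1 \<in> e}"
    using finite_incident[OF V] by (rule card_mono[rotated])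
  ultimately show ?thesis using degree[OF V] by (simp add: vertex_degree_def)
qed

section \<open>Edge sets as cochains mod 2, evaluated along words\<close>

fun parity :: "'a gword set set set \<Rightarrow> 'a gword set \<Rightarrow> 'a gword \<Rightarrow> bool" where
  "parity P g [] = False"
| "parity P g (x # w) = (({g, g \<otimes>\<^bsub>Gp\<^esub> cl [x]} \<in> P) \<noteq> parity P (g \<otimes>\<^bsub>Gp\<^esub> cl [x]) w)"

lemma parity_append:
  assumes "g \<in> V" "u \<in> words S" "w \<in> words S"
  shows "parity P g (u @ w) = (parity P g u \<noteq> parity P (g \<otimes>\<^bsub>Gp\<^esub> cl u) w)"
  using assms
proof (induction u arbitrary: g)
  case Nil
  then show ?case by (simp add: cl_nil)
next
  case (Cons x u)
  have xu: "x \<in> letters" "u \<in> words S" using Cons.prems by (auto simp: Cons_words)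
  then show ?case
    using Cons.prems Cons.IH[of "g \<otimes>\<^bsub>Gp\<^esub> cl [x]"]
    by (auto simp: cl_Cons[of x u] P.m_assoc cl_letter cl_closed)
qed

text \<open>Both elementary moves preserve parity: an inverse pair crosses one edge twice, and a
  relator is even by assumption and returns to its starting vertex.\<close>

lemma parity_pres_eq:
  assumes rel: "\<And>g r. g \<in> V \<Longrightarrow> r \<in> R \<Longrightarrow> \<not> parity P g r"
    and "pres_eq S R u w" "g \<in> V"
  shows "parity P g u = parity P g w"
  using assms(2,3)
proof (induction arbitrary: g rule: pres_eq.induct)
  case (cancel u v s b)
  have w: "[(s, b), (s, \<not> b)] \<in> words S" using cancel by (simp add: words_def)
  let ?h = "g \<otimes>\<^bsub>Gp\<^esub> cl u"
  have h: "?h \<in> V" using cancel by (simp add: cl_closed)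
  have c: "(?h \<otimes>\<^bsub>Gp\<^esub> cl [(s, b)]) \<otimes>\<^bsub>Gp\<^esub> cl [(s, \<not> b)] = ?h"
    using h cancel by (intro mult_letter_cancel)
  have "cl [(s, b), (s, \<not> b)] = \<one>\<^bsub>Gp\<^esub>"
    using cancel cl_Cons[of "(s, b)" "[(s, \<not> b)]"] by (simp add: words_def cl_inverse_letters)
  moreover have "\<not> parity P ?h [(s, b), (s, \<not> b)]"
    by (simp add: c insert_commute)
  ultimately have "parity P ?h ([(s, b), (s, \<not> b)] @ v) = parity P ?h v"
    using h w cancel by (subst parity_append) auto
  then show ?case
    using cancel w by (simp only: parity_append append_in_words)
next
  case (relator u v r)
  let ?h = "g \<otimes>\<^bsub>Gp\<^esub> cl u"
  have h: "?h \<in> V" using relator by (simp add: cl_closed)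
  have "parity P ?h (r @ v) = parity P ?h v"
    using h relator rel[OF h relator(3)] by (subst parity_append) (auto simp: cl_relator)
  then show ?case
    using relator by (simp only: parity_append append_in_words)
qed auto

lemma length_walk: "length (word_walk S R g w) = Suc (length w)"
  by (induction w arbitrary: g) auto

lemma parity_cong:
  assumes "\<And>i. i < length w \<Longrightarrow>
    {word_walk S R g w ! i, word_walk S R g w ! Suc i} \<in> P \<longleftrightarrow>
    {word_walk S R g w ! i, word_walk S R g w ! Suc i} \<in> Q"
  shows "parity P g w = parity Q g w"
  using assms
proof (induction w arbitrary: g)
  case (Cons x w)
  have hd: "word_walk S R h w ! 0 = h" for h by (cases w) auto
  have "({g, g \<otimes>\<^bsub>Gp\<^esub> cl [x]} \<in> P) = ({g, g \<otimes>\<^bsub>Gp\<^esub> cl [x]} \<in> Q)"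
    using Cons.prems[of 0] by (simp add: hd)
  moreover have "parity P (g \<otimes>\<^bsub>Gp\<^esub> cl [x]) w = parity Q (g \<otimes>\<^bsub>Gp\<^esub> cl [x]) w"
    using Cons.prems[of "Suc _"] by (intro Cons.IH) auto
  ultimately show ?case by simp
qed simp

definition cut :: "'a gword set set \<Rightarrow> 'a gword set set set" where
  "cut D = {e \<in> E. \<exists>x y. e = {x, y} \<and> x \<in> D \<and> y \<notin> D}"

lemma cut_iff: "{x, y} \<in> cut D \<longleftrightarrow> {x, y} \<in> E \<and> (x \<in> D) \<noteq> (y \<in> D)"
  by (auto simp: cut_def doubleton_eq_iff)

lemma parity_cut:
  assumes "g \<in> V" "w \<in> words S"
  shows "parity (cut D) g w \<longleftrightarrow> (g \<in> D) \<noteq> (g \<otimes>\<^bsub>Gp\<^esub> cl w \<in> D)"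
  using assms
proof (induction w arbitrary: g)
  case Nil
  then show ?case by (simp add: cl_nil)
next
  case (Cons x w)
  have xw: "x \<in> letters" "w \<in> words S" using Cons.prems by (auto simp: Cons_words)
  then show ?case
    using Cons.prems Cons.IH[of "g \<otimes>\<^bsub>Gp\<^esub> cl [x]"] letter_edge[of g x]
    by (auto simp: cl_Cons[of x w] P.m_assoc cl_letter cl_closed cut_iff)
qed

definition conn_set :: "'a gword set set \<Rightarrow> bool" where
  "conn_set D \<longleftrightarrow> (\<forall>x\<in>D. \<forall>y\<in>D. (x, y) \<in> {(a, b). {a, b} \<in> E \<and> a \<in> D \<and> b \<in> D}\<^sup>*)"

lemma conn_set_const:
  assumes "conn_set D" "\<And>a b. {a, b} \<in> E \<Longrightarrow> a \<in> D \<Longrightarrow> b \<in> D \<Longrightarrow> c a = c b" "x \<in> D" "y \<in> D"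
  shows "c x = c y"
proof -
  have "(x, y) \<in> {(a, b). {a, b} \<in> E \<and> a \<in> D \<and> b \<in> D}\<^sup>*"
    using assms by (auto simp: conn_set_def)
  then show ?thesis by induction (use assms(2) in auto)
qed

text \<open>The potential of \<open>g\<close> is the parity of any word leading from the identity to
  \<open>g\<close>; \<open>parity_pres_eq\<close> makes this well defined. In other words, a cochain
  vanishing on the relators is a coboundary.\<close>

lemma parity_potential:
  assumes rel: "\<And>g r. g \<in> V \<Longrightarrow> r \<in> R \<Longrightarrow> \<not> parity P g r"
  obtains c :: "'a gword set \<Rightarrow> bool" where "\<And>x y. {x, y} \<in> E \<Longrightarrow> {x, y} \<in> P \<longleftrightarrow> c x \<noteq> c y"
proof -
  define c where "c g = parity P \<one>\<^bsub>Gp\<^esub> (SOME u. u \<in> words S \<and> g = cl u)" for g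
  have c: "c (cl u) = parity P \<one>\<^bsub>Gp\<^esub> u" if "u \<in> words S" for u
  proof -
    let ?u = "SOME u'. u' \<in> words S \<and> cl u = cl u'"
    have "?u \<in> words S \<and> cl u = cl ?u" by (rule someI[of _ u]) (use that in simp)
    then have "pres_eq S R u ?u" using that word_class_eq_iff by blast
    from rel this P.one_closed have "parity P \<one>\<^bsub>Gp\<^esub> u = parity P \<one>\<^bsub>Gp\<^esub> ?u"
      by (rule parity_pres_eq)
    then show ?thesis unfolding c_def by (rule HOL.sym)
  qed
  have step: "{g, g \<otimes>\<^bsub>Gp\<^esub> cl [x]} \<in> P \<longleftrightarrow> c g \<noteq> c (g \<otimes>\<^bsub>Gp\<^esub> cl [x])" if g: "g \<in> V" and "x \<in> letters" for g x
  proof -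
    obtain u where u: "u \<in> words S" "g = cl u" using VE[OF g] by blast
    have x: "[x] \<in> words S" using that by (simp add: words_def)
    show ?thesis
      using c[OF append_in_words[OF u(1) x]] c[OF u(1)] u x
      by (auto simp: parity_append cl_append cl_closed)
  qed
  show ?thesis
  proof (rule that)
    fix x y assume "{x, y} \<in> E"
    then obtain g s where *: "g \<in> V" "s \<in> S" "{x, y} = {g, g \<otimes>\<^bsub>Gp\<^esub> cl [(s, True)]}" by (rule edgeE)
    let ?h = "g \<otimes>\<^bsub>Gp\<^esub> cl [(s, True)]"
    have "c x \<noteq> c y \<longleftrightarrow> c g \<noteq> c ?h"
      using *(3) by (auto simp: doubleton_eq_iff)
    then show "{x, y} \<in> P \<longleftrightarrow> c x \<noteq> c y"
      unfolding *(3) using step[of g "(s, True)"] * by simp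
  qed
qed

text \<open>A set of cut edges that meets every relator cycle evenly is the coboundary of a potential. A potential
  that is constant along all edges inside the two sides has the whole cut or nothing as its coboundary.\<close>

lemma cut_relator:
  assumes D: "conn_set D" "conn_set (V - D)"
    and P: "P \<subseteq> cut D" "e \<in> P" "e' \<in> cut D" "e' \<notin> P"
  obtains r g i j where "r \<in> R" "g \<in> V" "is_cycle E (word_walk S R g r)" "i < length r" "j < length r"
    "{word_walk S R g r ! i, word_walk S R g r ! Suc i} \<in> P"
    "{word_walk S R g r ! j, word_walk S R g r ! Suc j} \<in> cut D - P"
proof (rule ccontr)
  note found = that
  assume neg: "\<not> thesis"
  have "\<not> parity P g r" if g: "g \<in> V" and r: "r \<in> R" for g r
  proof (cases "\<exists>x. r = [x, x]")
    case True
    \<comment> \<open>The relator goes forth and back along one edge, so the two steps cancel mod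
      2.\<close>
    then obtain x where x: "r = [x, x]" by auto
    then have xl: "x \<in> letters" using R_words r by (auto simp: words_def)
    have "g \<otimes>\<^bsub>Gp\<^esub> cl [x] \<otimes>\<^bsub>Gp\<^esub> cl [x] = g \<otimes>\<^bsub>Gp\<^esub> cl r"
      using g xl cl_Cons[of x "[x]"] x by (simp add: P.m_assoc cl_letter words_def)
    then show ?thesis using x g r by (simp add: cl_relator insert_commute)
  next
    case False
    then have cyc: "is_cycle E (word_walk S R g r)"
      using relator_cycles r g unfolding relators_induce_cycles_def by blast
    let ?e = "\<lambda>i. {word_walk S R g r ! i, word_walk S R g r ! Suc i}"
    show ?thesis
    proof (cases "\<exists>i<length r. ?e i \<in> P")
      case True
      \<comment> \<open>A cycle meeting \<open>P\<close> crosses the cut only in \<open>P\<close>;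
        its parity is then that of the whole cut, which every closed walk crosses evenly.\<close>
      then have none: "?e j \<notin> cut D - P" if "j < length r" for j
        using neg found[OF r g cyc _ that] True that by blast
      have "parity P g r = parity (cut D) g r"
        by (rule parity_cong) (use none P(1) in blast)
      also have "\<not> \<dots>"
        using r R_words g by (subst parity_cut) (auto simp: cl_relator)
      finally show ?thesis by simp
    next
      case none: False
      have "parity P g r = parity {} g r"
        by (rule parity_cong) (use none in auto)
      also have "\<not> parity {} h w" for h w by (induction w arbitrary: h) auto
      finally show ?thesis .
    qed
  qed
  then obtain c :: "'a gword set \<Rightarrow> bool" where c: "\<And>x y. {x, y} \<in> E \<Longrightarrow> {x, y} \<in> P \<longleftrightarrow> c x \<noteq> c y"
    using parity_potential by metis
  have nP: "c a = c b" if "{a, b} \<in> E" "a \<in> D \<longleftrightarrow> b \<in> D" for a b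
    using that P(1) c[of a b] cut_iff[of a b D] by blast
  obtain x y where e: "e = {x, y}" "x \<in> D" "y \<notin> D" "{x, y} \<in> E" using P by (auto simp: cut_def)
  obtain x' y' where e': "e' = {x', y'}" "x' \<in> D" "y' \<notin> D" "{x', y'} \<in> E" using P by (auto simp: cut_def)
  have "c x = c x'" using D(1) by (rule conn_set_const) (use nP e e' in auto)
  moreover have "c y = c y'"
    using D(2) by (rule conn_set_const) (use nP e e' edges_sub in auto)
  ultimately show False using c[OF e(4)] c[OF e'(4)] e e' P by auto
qed

end

section \<open>One-ended Cayley graphs\<close>

lemma cluster_refl: "v \<in> cluster E \<omega> v"
  by (simp add: cluster_def)

lemma cluster_step: "x \<in> cluster E \<omega> v \<Longrightarrow> {x, y} \<in> E \<Longrightarrow> \<omega> {x, y} \<Longrightarrow> y \<in> cluster E \<omega> v"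
  unfolding cluster_def by (auto intro: rtrancl_into_rtrancl)

lemma cluster_subset:
  assumes "v \<in> X" "\<And>x y. x \<in> X \<Longrightarrow> {x, y} \<in> E \<Longrightarrow> \<omega> {x, y} \<Longrightarrow> y \<in> X"
  shows "cluster E \<omega> v \<subseteq> X"
proof
  fix w assume "w \<in> cluster E \<omega> v"
  then have "(v, w) \<in> {(x, y). {x, y} \<in> E \<and> \<omega> {x, y}}\<^sup>*" by (simp add: cluster_def)
  then show "w \<in> X" by induction (use assms in auto)
qed

locale one_ended_presentation = cayley_presentation +
  fixes v
  assumes one_ended: "one_ended E"
    and v: "v \<in> V"
begin

definition ray :: "nat \<Rightarrow> 'a gword set" where
  "ray = (SOME f. f 0 = v \<and> (\<forall>n. {f n, f (Suc n)} \<in> E) \<and> (\<forall>n. gdist E v (f n) = n))"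

lemma ray: "ray 0 = v" "{ray n, ray (Suc n)} \<in> E" "gdist E v (ray n) = n"
proof -
  obtain f where "f 0 = v" "\<And>n. {f n, f (Suc n)} \<in> E" "\<And>n. gdist E v (f n) = n"
    using geodesic_ray_from[OF v] by blast
  then have "f 0 = v \<and> (\<forall>n. {f n, f (Suc n)} \<in> E) \<and> (\<forall>n. gdist E v (f n) = n)" by simp
  then have "ray 0 = v \<and> (\<forall>n. {ray n, ray (Suc n)} \<in> E) \<and> (\<forall>n. gdist E v (ray n) = n)"
    unfolding ray_def
    by (rule someI[where P = "\<lambda>f. f 0 = v \<and> (\<forall>n. {f n, f (Suc n)} \<in> E) \<and> (\<forall>n. gdist E v (f n) = n)"])
  then show "ray 0 = v" "{ray n, ray (Suc n)} \<in> E" "gdist E v (ray n) = n" by auto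
qed

lemma ray_V: "ray n \<in> V"
  using ray(2)[of n] edges_sub by auto

lemma ray_rays: "ray \<in> rays E"
  using inj_geodesic[of E v ray] ray by (simp add: rays_def)

definition separates :: "'a gword set set set \<Rightarrow> bool" where
  "separates K \<longleftrightarrow> finite (cluster E (\<lambda>e. e \<notin> K) v)"

lemma cluster_V: "cluster E \<omega> v \<subseteq> V"
  using v edges_sub by (intro cluster_subset) auto

text \<open>\<open>D\<close> is the component of the complement of the cluster that contains the
  tail of \<open>ray\<close>. The other side is connected through the cluster, and finite because a
  second infinite part would contain a ray that one-endedness forces into \<open>D\<close>.\<close>

lemma finite_cluster_cut:
  assumes fin: "finite (cluster E \<omega> v)"
  obtains D where "D \<subseteq> V" "v \<notin> D" "conn_set D" "conn_set (V - D)" "finite (V - D)"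
    "\<And>e. e \<in> cut D \<Longrightarrow> \<not> \<omega> e" "\<exists>n. ray n \<in> D"
proof -
  define C where "C = cluster E \<omega> v"
  have C: "finite C" "C \<subseteq> V" "v \<in> C" using fin cluster_V cluster_refl by (auto simp: C_def)
  obtain N where N: "\<And>i j. N \<le> i \<Longrightarrow> N \<le> j \<Longrightarrow> same_component_avoiding E C (ray i) (ray j)"
    using ray_tail[OF ray_rays C(1)] by blast
  define z where "z = ray N"
  let ?r = "{(x, y). {x, y} \<in> E \<and> x \<notin> C \<and> y \<notin> C}"
  define D where "D = {y. y \<notin> C \<and> (z, y) \<in> ?r\<^sup>*}"
  have z: "z \<notin> C" "z \<in> V" using N[of N N] ray_V by (auto simp: same_component_avoiding_def z_def)
  have D_iff: "y \<in> D \<longleftrightarrow> same_component_avoiding E C z y" for y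
    using z by (auto simp: D_def same_component_avoiding_def)
  have D_step: "y \<in> D" if "x \<in> D" "{x, y} \<in> E" "y \<notin> C" for x y
    using that unfolding D_def by (auto intro: rtrancl_into_rtrancl)
  have D_V: "D \<subseteq> V"
  proof
    fix y assume "y \<in> D"
    then have "(z, y) \<in> ?r\<^sup>*" by (simp add: D_def)
    then show "y \<in> V" by induction (use z edges_sub in auto)
  qed
  let ?rD = "{(a, b). {a, b} \<in> E \<and> a \<in> D \<and> b \<in> D}"
  have from_z: "(z, y) \<in> ?rD\<^sup>* \<and> (y, z) \<in> ?rD\<^sup>*" if "y \<in> D" for y
  proof -
    have "(z, y) \<in> ?r\<^sup>*" using that by (simp add: D_def)
    then show ?thesis
    proof induction
      case (step x y)
      have "(z, x) \<in> ?r\<^sup>*" "(z, y) \<in> ?r\<^sup>*" using step by (auto intro: rtrancl_into_rtrancl)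
      then have "x \<in> D" "y \<in> D" using step by (auto simp: D_def)
      then have "(x, y) \<in> ?rD" "(y, x) \<in> ?rD" using step by (auto simp: insert_commute)
      then show ?case using step.IH
        by (meson converse_rtrancl_into_rtrancl rtrancl.rtrancl_into_rtrancl)
    qed simp
  qed
  have conn_D: "conn_set D"
    unfolding conn_set_def using from_z by (meson rtrancl_trans)
  let ?rC = "{(a, b). {a, b} \<in> E \<and> a \<in> V - D \<and> b \<in> V - D}"
  have C_D: "C \<subseteq> V - D" using C by (auto simp: D_def)
  have cl: "(v, w) \<in> ?rC\<^sup>*" if "w \<in> C" for w
  proof -
    have "(v, w) \<in> {(x, y). {x, y} \<in> E \<and> \<omega> {x, y}}\<^sup>*"
      using that by (simp add: C_def cluster_def)
    then show ?thesis
    proof induction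
      case (step x y)
      have "x \<in> C" using step(1) by (auto simp: C_def cluster_def)
      moreover have "y \<in> C" using \<open>x \<in> C\<close> step(2) unfolding C_def by (auto intro: cluster_step)
      ultimately have "(x, y) \<in> ?rC" using step(2) C_D by auto
      then show ?case using step.IH by (rule rtrancl_into_rtrancl[rotated])
    qed simp
  qed
  have sym_rC: "(y, x) \<in> ?rC" if "(x, y) \<in> ?rC" for x y using that by (auto simp: insert_commute)
  have sym_rC': "(y, x) \<in> ?rC\<^sup>*" if "(x, y) \<in> ?rC\<^sup>*" for x y
    using that
  proof induction
    case (step y z)
    show ?case by (rule converse_rtrancl_into_rtrancl[OF sym_rC[OF step(2)] step.IH])
  qed simp
  \<comment> \<open>A walk to \<open>v\<close> from outside \<open>D\<close> cannot enter
    \<open>D\<close> before it meets \<open>C\<close>, and inside \<open>C\<close> the open paths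
    lead to \<open>v\<close>.\<close>
  have from_v: "(v, y) \<in> ?rC\<^sup>*" if y: "y \<in> V - D" for y
  proof -
    have "(y, v) \<in> (adj E)\<^sup>*" using y v by (intro connected) auto
    then have "y \<in> V - D \<longrightarrow> (y, v) \<in> ?rC\<^sup>*"
    proof (induction rule: converse_rtrancl_induct)
      case (step y z)
      show ?case
      proof
        assume y: "y \<in> V - D"
        show "(y, v) \<in> ?rC\<^sup>*"
        proof (cases "y \<in> C")
          case True
          then show ?thesis by (rule sym_rC'[OF cl])
        next
          case False
          have "z \<notin> D" using D_step[of z y] step y False by (auto simp: adj_def insert_commute)
          then have "z \<in> V - D" using step adj_V by auto
          then have "(y, z) \<in> ?rC" using y step by (auto simp: adj_def)
          then show ?thesis using step.IH \<open>z \<in> V - D\<close> by (blast intro: converse_rtrancl_into_rtrancl)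
        qed
      qed
    qed simp
    then have "(y, v) \<in> ?rC\<^sup>*" using y by simp
    then show ?thesis by (rule sym_rC')
  qed
  have conn_VD: "conn_set (V - D)"
    unfolding conn_set_def using from_v sym_rC' by (meson rtrancl_trans)
  have ray_D: "ray n \<in> D" if "N \<le> n" for n
    unfolding D_iff z_def using N that by simp
  have fin_VD: "finite (V - D)"
  proof (rule ccontr)
    assume inf: "infinite (V - D)"
    \<comment> \<open>Koenig's lemma is applied to the induced graph on \<open>V - D\<close>, so
      that the resulting ray stays there.\<close>
    define F where "F = {e \<in> E. e \<subseteq> V - D}"
    have "?rC = adj F" by (auto simp: adj_def F_def)
    then have "V - D \<subseteq> {w. (v, w) \<in> (adj F)\<^sup>*}" using from_v by auto
    then have "infinite {w. (v, w) \<in> (adj F)\<^sup>*}" using inf finite_subset by blast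
    moreover have "finite {y. {x, y} \<in> F}" for x
      by (rule finite_subset[OF _ finite_nbr[of x]]) (auto simp: F_def)
    ultimately obtain g where g: "\<And>n. {g n, g (Suc n)} \<in> F" "\<And>n. gdist F v (g n) = n"
      using geodesic_ray[of F v] by blast
    have "g \<in> rays E" using inj_geodesic[OF g(2)] g(1) by (auto simp: rays_def F_def)
    then obtain N' where N': "\<And>i j. N' \<le> i \<Longrightarrow> N' \<le> j \<Longrightarrow> same_component_avoiding E C (ray i) (g j)"
      using one_ended_rays[OF one_ended ray_rays _ C(1)] by blast
    let ?i = "max N N'"
    have "same_component_avoiding E C (ray ?i) (g ?i)" "same_component_avoiding E C z (ray ?i)"
      using N'[of ?i ?i] N[of N ?i] by (auto simp: z_def)
    then have "same_component_avoiding E C z (g ?i)"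
      unfolding same_component_avoiding_def by (auto intro: rtrancl_trans)
    then have "g ?i \<in> D" by (simp add: D_iff)
    then show False using g(1)[of ?i] by (auto simp: F_def)
  qed
  have vac: "\<not> \<omega> e" if e_cut: "e \<in> cut D" for e
  proof
    assume "\<omega> e"
    obtain x y where e: "e = {x, y}" "x \<in> D" "y \<notin> D" "{x, y} \<in> E" using e_cut by (auto simp: cut_def)
    then have "y \<in> C" using D_step by blast
    then have "x \<in> C" using cluster_step[of y E \<omega> v x] e \<open>\<omega> e\<close> by (simp add: C_def insert_commute)
    then show False using e by (simp add: D_def)
  qed
  show ?thesis
    using D_V C_D C conn_D conn_VD fin_VD vac ray_D[of N] by (intro that[of D]) auto
qed

lemma cut_separates:
  assumes "v \<in> V - D" "finite (V - D)" "cut D \<subseteq> K"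
  shows "separates K"
proof -
  have "cluster E (\<lambda>e. e \<notin> K) v \<subseteq> V - D"
  proof (rule cluster_subset)
    fix x y assume "x \<in> V - D" "{x, y} \<in> E" "{x, y} \<notin> K"
    then show "y \<in> V - D" using assms(3) cut_iff[of x y D] edges_sub by blast
  qed (use assms in simp)
  then show ?thesis unfolding separates_def using assms(2) by (rule finite_subset)
qed

text \<open>A long two-sided geodesic through \<open>v\<close> replaces a bi-infinite one, so no second compactness
  argument is needed.\<close>

lemma separates_two_sided:
  assumes "separates K"
  obtains y M j k where "\<And>j. {y j, y (Suc j)} \<in> E"
    "\<And>j k n. j \<le> k \<Longrightarrow> (y j, y k) \<in> adj E ^^ n \<Longrightarrow> k \<le> j + n"
    "y M = v" "k < M" "M \<le> j" "{y k, y (Suc k)} \<in> K" "{y j, y (Suc j)} \<in> K"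
proof -
  define C where "C = cluster E (\<lambda>e. e \<notin> K) v"
  \<comment> \<open>The \<open>M + 1\<close> vertices \<open>y 0, ..., y M\<close> cannot all lie in
    \<open>C\<close>, so the geodesic crosses \<open>K\<close> before \<open>v\<close>; it crosses
    again after \<open>v\<close> because it is infinite in that direction.\<close>
  define M where "M = card C"
  have C: "finite C" "v \<in> C" using assms cluster_refl by (auto simp: C_def separates_def)
  obtain y where y: "y M = v" "\<And>j. {y j, y (Suc j)} \<in> E"
    "\<And>j k n. j \<le> k \<Longrightarrow> (y j, y k) \<in> adj E ^^ n \<Longrightarrow> k \<le> j + n"
    using two_sided_geodesic[OF v, where M = M] by blast
  have "j \<le> i" if "i \<le> j" "y i = y j" for i j
    using y(3)[OF that(1), of 0] that(2) by simp
  then have inj: "inj y" by (metis injI le_antisym nat_le_linear)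
  have step: "x' \<in> C" if "x \<in> C" "{x, x'} \<in> E" "{x, x'} \<notin> K" for x x'
    using that unfolding C_def by (rule cluster_step)
  obtain j where j: "M \<le> j" "{y j, y (Suc j)} \<in> K"
  proof (rule ccontr)
    note found = that
    assume not_thesis: "\<not> thesis"
    then have neg: "{y j, y (Suc j)} \<notin> K" if "M \<le> j" for j using found[OF that] not_thesis by blast
    have "y (M + n) \<in> C" for n
    proof (induction n)
      case (Suc n)
      then show ?case using step[OF Suc y(2)] neg[of "M + n"] by simp
    qed (use C y in simp)
    then have "range (\<lambda>n. y (M + n)) \<subseteq> C" by auto
    moreover have "inj (\<lambda>n. y (M + n))" 
    proof (rule injI)
      fix a b assume "y (M + a) = y (M + b)"
      then have "M + a = M + b" by (rule injD[OF inj])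
      then show "a = b" by simp
    qed
    ultimately show False using C(1) finite_subset range_inj_infinite by blast
  qed
  obtain k where k: "k < M" "{y k, y (Suc k)} \<in> K"
  proof (rule ccontr)
    note found = that
    assume not_thesis: "\<not> thesis"
    then have neg: "{y k, y (Suc k)} \<notin> K" if "k < M" for k using found[OF that] not_thesis by blast
    have "y (M - n) \<in> C" if "n \<le> M" for n
      using that
    proof (induction n)
      case (Suc n)
      then have "Suc (M - Suc n) = M - n" by simp
      then show ?case using step[of "y (M - n)" "y (M - Suc n)"] Suc y(2)[of "M - Suc n"] neg[of "M - Suc n"]
        by (simp add: insert_commute)
    qed (use C y in simp)
    then have "y i \<in> C" if "i \<le> M" for i using that by (metis diff_diff_cancel diff_le_self)
    then have "y ` {..M} \<subseteq> C" by auto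
    then have "card (y ` {..M}) \<le> card C" using C(1) by (rule card_mono[rotated])
    moreover have "card (y ` {..M}) = Suc M" using inj by (simp add: card_image inj_on_subset)
    ultimately show False by (simp add: M_def)
  qed
  show ?thesis using that[OF y(2,3,1) k(1) j(1) k(2) j(2)] by blast
qed

text \<open>Ensures that the maximum defining \<open>longest_relator_cycle\<close> ranges over a
  nonempty set. With all edges vacant, the resulting cut contains two different edges; splitting off
  one of them makes \<open>cut_relator\<close> produce a cycle.\<close>

lemma relator_cycle_exists:
  obtains r g where "r \<in> R" "g \<in> V" "is_cycle E (word_walk S R g r)"
proof -
  have "cluster E (\<lambda>_. False) v \<subseteq> {v}" by (rule cluster_subset) auto
  then have "finite (cluster E (\<lambda>_. False) v)" by (rule finite_subset) simp
  then obtain D where D: "v \<notin> D" "conn_set D" "conn_set (V - D)" "finite (V - D)"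
    by (rule finite_cluster_cut) blast
  have "separates (cut D)" using D v by (intro cut_separates) auto
  then obtain y M j k where y: "\<And>j k n. j \<le> k \<Longrightarrow> (y j, y k) \<in> adj E ^^ n \<Longrightarrow> k \<le> j + n"
    and jk: "k < M" "M \<le> j" "{y k, y (Suc k)} \<in> cut D" "{y j, y (Suc j)} \<in> cut D"
    by (rule separates_two_sided) blast
  have "y k \<noteq> y j" "y k \<noteq> y (Suc j)" using y[of k j 0] y[of k "Suc j" 0] jk by auto
  then have "{y j, y (Suc j)} \<notin> {{y k, y (Suc k)}}" by auto
  then have "\<exists>r\<in>R. \<exists>g\<in>V. is_cycle E (word_walk S R g r)"
    by (rule cut_relator[OF D(2,3) _ _ jk(4), of _ "{y k, y (Suc k)}", rotated 2]) (use jk in blast)+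
  then show ?thesis using that by blast
qed

section \<open>Closeness of edges and connectedness of cuts\<close>

definition half_cycle :: nat where
  "half_cycle = longest_relator_cycle S R div 2"

lemma finite_relator_lengths: "finite {length p - 1 | p. is_cycle E p \<and>
    (\<exists>r\<in>R. \<exists>g\<in>V. p = word_walk S R g r)}"
  by (rule finite_subset[of _ "length ` R"]) (use finite_R in \<open>auto simp: length_walk\<close>)

lemma length_relator_le:
  assumes "r \<in> R" "g \<in> V" "is_cycle E (word_walk S R g r)"
  shows "length r \<le> longest_relator_cycle S R"
  unfolding longest_relator_cycle_def
proof (rule Max_ge[OF finite_relator_lengths])
  have "length r = length (word_walk S R g r) - 1" by (simp add: length_walk)
  then show "length r \<in> {length p - 1 | p. is_cycle E p \<and> (\<exists>r\<in>R. \<exists>g\<in>V. p = word_walk S R g r)}"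
    using assms by blast
qed

lemma half_cycle_pos: "1 \<le> half_cycle"
proof -
  obtain r g where r: "r \<in> R" "g \<in> V" "is_cycle E (word_walk S R g r)"
    by (rule relator_cycle_exists)
  then have "3 \<le> length r" by (auto simp: is_cycle_def length_walk)
  then show ?thesis using length_relator_le[OF r] by (simp add: half_cycle_def)
qed

definition H :: "('a gword set set \<times> 'a gword set set) set" where
  "H = {(e, f). e \<in> E \<and> f \<in> E \<and> e \<noteq> f \<and> (e, f) \<in> line E ^^ half_cycle}"

definition \<Delta> :: nat where
  "\<Delta> = (2 * deg - 2) ^ half_cycle"

lemma \<Delta>_ge_2: "2 \<le> \<Delta>"
proof -
  have "(2 * deg - 2) ^ 1 \<le> (2 * deg - 2) ^ half_cycle"
    using deg_ge_2 half_cycle_pos by (intro power_increasing) auto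
  then show ?thesis using deg_ge_2 by (simp add: \<Delta>_def)
qed

sublocale bounded_relation E H \<Delta>
proof
  show "sym H" by (rule symI) (auto simp: H_def intro: line_relpow_commute)
  fix e assume e: "e \<in> E"
  have sub: "H `` {e} \<subseteq> (line E ^^ half_cycle) `` {e} - {e}" by (auto simp: H_def)
  then show "finite (H `` {e})" using card_line_ball[OF e] finite_subset by blast
  show "card (H `` {e}) \<le> \<Delta>"
    using card_mono[OF _ sub] card_line_ball[OF e, of half_cycle] by (auto simp: \<Delta>_def)
qed (use countable_edges \<Delta>_ge_2 in \<open>auto simp: H_def\<close>)

lemma cycle_edges_close:
  assumes p: "is_cycle E p" and n: "length p = Suc n" "n div 2 \<le> half_cycle" and ij: "i < n" "j < n"
  shows "({p ! i, p ! Suc i}, {p ! j, p ! Suc j}) \<in> line E ^^ half_cycle"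
proof -
  let ?a = "\<lambda>i. {p ! i, p ! Suc i}"
  have E: "?a i \<in> E" if "i < n" for i using p n that by (auto simp: is_cycle_def)
  have fwd: "(?a i, ?a (i + k)) \<in> line E ^^ k" if "i + k < n" for i k
    using that
  proof (induction k)
    case (Suc k)
    have "(?a (i + k), ?a (i + Suc k)) \<in> line E"
      using Suc.prems E by (auto simp: line_def)
    then show ?case using Suc by auto
  qed simp
  have p0: "p ! 0 = p ! n"
  proof -
    have "p \<noteq> []" using n by auto
    then show ?thesis using p n by (simp add: is_cycle_def last_conv_nth hd_conv_nth)
  qed
  have close: "(?a i, ?a j) \<in> line E ^^ half_cycle" if "i \<le> j" "j < n" for i j
  proof (cases "j - i \<le> n div 2")
    case True
    have "(?a i, ?a j) \<in> line E ^^ (j - i)" using fwd[of i "j - i"] that by simp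
    moreover have "j - i \<le> half_cycle" using True n(2) by simp
    moreover have "?a i \<in> E" using that by (intro E) simp
    ultimately show ?thesis by (rule line_relpow_mono)
  next
    case False
    \<comment> \<open>The long arc is replaced by the other one, through the closing vertex
      \<open>p ! 0 = p ! n\<close>; its length is
      \<open>i + 1 + (n - 1 - j) = n - (j - i)\<close>.\<close>
    have "(?a 0, ?a i) \<in> line E ^^ i" using fwd[of 0 i] that by simp
    then have 1: "(?a i, ?a 0) \<in> line E ^^ i" by (rule line_relpow_commute)
    have "(?a 0, ?a (n - 1)) \<in> line E ^^ 1"
      using E[of 0] E[of "n - 1"] that p0 by (auto simp: line_def)
    with 1 have 2: "(?a i, ?a (n - 1)) \<in> line E ^^ (i + 1)" by (rule relpow_trans)
    have "(?a j, ?a (n - 1)) \<in> line E ^^ (n - 1 - j)" using fwd[of j "n - 1 - j"] that by simp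
    then have "(?a (n - 1), ?a j) \<in> line E ^^ (n - 1 - j)" by (rule line_relpow_commute)
    with 2 have "(?a i, ?a j) \<in> line E ^^ (i + 1 + (n - 1 - j))" by (rule relpow_trans)
    moreover have "i + 1 + (n - 1 - j) \<le> half_cycle" using False that n(2) by linarith
    moreover have "?a i \<in> E" using that by (intro E) simp
    ultimately show ?thesis by (rule line_relpow_mono)
  qed
  show ?thesis
    using close[of i j] close[of j i] ij line_relpow_commute by (cases "i \<le> j") auto
qed

text \<open>If closeness left part of the cut unreached, \<open>cut_relator\<close> would give a
  relator cycle with one edge in each part, and two edges of such a cycle are close.\<close>

lemma cut_connected:
  assumes D: "conn_set D" "conn_set (V - D)" and e: "e \<in> cut D"
  shows "reach H {e} (cut D) = cut D"
proof (rule ccontr)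
  let ?P = "reach H {e} (cut D)"
  assume "?P \<noteq> cut D"
  then obtain e' where e': "e' \<in> cut D" "e' \<notin> ?P" using reach_subset[of H "{e}" "cut D"] by blast
  have "e \<in> ?P" using e reach_base[of "{e}" "cut D" H] by auto
  then obtain r g i j where r: "r \<in> R" "g \<in> V" "is_cycle E (word_walk S R g r)" "i < length r" "j < length r"
    and ij: "{word_walk S R g r ! i, word_walk S R g r ! Suc i} \<in> ?P" (is "?a \<in> _")
    "{word_walk S R g r ! j, word_walk S R g r ! Suc j} \<in> cut D - ?P" (is "?b \<in> _")
    using cut_relator[OF D reach_subset _ e'] by metis
  have "length r div 2 \<le> half_cycle" using length_relator_le[OF r(1-3)] by (simp add: half_cycle_def div_le_mono)
  then have "(?a, ?b) \<in> line E ^^ half_cycle"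
    using cycle_edges_close[OF r(3) length_walk _ r(4,5)] by blast
  moreover have "?a \<in> cut D" using ij(1) by (rule subsetD[OF reach_subset])
  moreover have "cut D \<subseteq> E" by (auto simp: cut_def)
  ultimately have "(?a, ?b) \<in> H" using ij by (auto simp: H_def)
  then have "?b \<in> ?P" using reach_step[OF ij(1)] ij(2) by blast
  then show False using ij(2) by blast
qed

section \<open>Diameter and size of separating edge sets\<close>

lemma H_relpow_line: "(e, f) \<in> (H \<inter> K \<times> K) ^^ n \<Longrightarrow> (e, f) \<in> line E ^^ (n * half_cycle)"
proof (induction n arbitrary: f)
  case (Suc n)
  then obtain f' where f': "(e, f') \<in> (H \<inter> K \<times> K) ^^ n" "(f', f) \<in> H" by auto
  have "(e, f) \<in> line E ^^ (n * half_cycle + half_cycle)"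
    using Suc.IH[OF f'(1)] f'(2) by (intro relpow_trans[of e f']) (auto simp: H_def)
  then show ?case by (simp add: add.commute)
qed simp

text \<open>A path may be taken no longer than the number of related pairs in \<open>K\<close>, at
  most \<open>\<Delta> * card K\<close>, and each of its steps spans \<open>half_cycle\<close> steps
  in the line graph. A linear bound is all that is required.\<close>

lemma conn_set_diameter:
  assumes K: "finite K" "K \<subseteq> E" "e \<in> K" "f \<in> K" "reach H {e} K = K" and x: "x \<in> e" "y \<in> f"
  obtains k where "k \<le> \<Delta> * card K * half_cycle + 1" "(x, y) \<in> adj E ^^ k"
proof -
  let ?r = "H \<inter> K \<times> K"
  have sub: "?r \<subseteq> Sigma K (\<lambda>e. H `` {e})" by auto
  have fin: "finite (H `` {e})" "card (H `` {e}) \<le> \<Delta>" if "e \<in> K" for e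
    using that K finite_nbrs card_nbrs by auto
  have "card ?r \<le> card (Sigma K (\<lambda>e. H `` {e}))"
    using sub K fin by (intro card_mono finite_SigmaI) auto
  also have "\<dots> = (\<Sum>e\<in>K. card (H `` {e}))" using K fin by (intro card_SigmaI) auto
  also have "\<dots> \<le> (\<Sum>e\<in>K. \<Delta>)" using fin by (intro sum_mono)
  finally have card: "card ?r \<le> \<Delta> * card K" by (simp add: mult.commute)
  have fin_r: "finite ?r" using sub K fin by (intro finite_subset[OF sub] finite_SigmaI) auto
  have "f \<in> reach H {e} K" using K(4,5) by simp
  then have "(e, f) \<in> ?r\<^sup>*" by (auto simp: reach_def)
  then obtain n where n: "n \<le> card ?r" "(e, f) \<in> ?r ^^ n"
    using rtrancl_finite_eq_relpow[OF fin_r] by auto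
  have eE: "e \<in> E" using K by auto
  have "n * half_cycle \<le> \<Delta> * card K * half_cycle" using n card by (intro mult_right_mono) auto
  then have "(e, f) \<in> line E ^^ (\<Delta> * card K * half_cycle)"
    using line_relpow_mono[OF H_relpow_line[OF n(2)] _ eE] by blast
  then show ?thesis using line_relpow_dist[OF _ x eE] that by blast
qed

definition ray_edge :: "nat \<Rightarrow> 'a gword set set" where
  "ray_edge i = {ray i, ray (Suc i)}"

lemma conn_reach_any:
  assumes "K \<in> conn e" "f \<in> K"
  shows "reach H {f} K = K"
proof
  show "reach H {f} K \<subseteq> K" by (rule reach_subset)
  have K: "e \<in> K" "reach H {e} K = K" using assms by (auto simp: conn_def)
  have "sym (H \<inter> K \<times> K)" using sym_H by (auto simp: sym_def)
  then have s: "sym ((H \<inter> K \<times> K)\<^sup>*)" by (rule sym_rtrancl)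
  have r: "(e, g) \<in> (H \<inter> K \<times> K)\<^sup>*" if "g \<in> K" for g
  proof -
    have "g \<in> reach H {e} K" using that K(2) by simp
    then show ?thesis by (auto simp: reach_def)
  qed
  have "(f, g) \<in> (H \<inter> K \<times> K)\<^sup>*" if "g \<in> K" for g
    using symD[OF s r[OF assms(2)]] r[OF that] by (rule rtrancl_trans)
  then show "K \<subseteq> reach H {f} K" using assms(2) by (auto simp: reach_def)
qed

text \<open>\<open>K\<close> meets a geodesic on both sides of \<open>v\<close>, so its diameter
  bound \<open>?N\<close> also bounds the distance from \<open>v\<close> to \<open>K\<close>. A
  second use of the bound reaches \<open>ray i\<close>, giving \<open>i \<le> 2 * ?N\<close>; the
  additive 2 is absorbed since \<open>K\<close> is nonempty.\<close>

lemma separates_size: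
  assumes K: "K \<in> conn (ray_edge i)" and sep: "separates K"
  shows "i \<le> (2 * \<Delta> * half_cycle + 2) * card K"
proof -
  let ?N = "\<Delta> * card K * half_cycle + 1"
  obtain y M j k where y: "\<And>j. {y j, y (Suc j)} \<in> E"
    "\<And>j k n. j \<le> k \<Longrightarrow> (y j, y k) \<in> adj E ^^ n \<Longrightarrow> k \<le> j + n"
    "y M = v" "k < M" "M \<le> j" "{y k, y (Suc k)} \<in> K" "{y j, y (Suc j)} \<in> K"
    by (rule separates_two_sided[OF sep]) blast
  have Kp: "finite K" "K \<subseteq> E" "ray_edge i \<in> K" using K by (auto simp: conn_def)
  let ?f = "{y k, y (Suc k)}"
  have reach: "reach H {?f} K = K" using conn_reach_any[OF K y(6)] .
  obtain n where n: "n \<le> ?N" "(y k, y (Suc j)) \<in> adj E ^^ n"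
    using conn_set_diameter[OF Kp(1,2) y(6,7) reach, of "y k" "y (Suc j)"] by auto
  have "Suc j \<le> k + n" using y(2)[OF _ n(2)] y(4,5) by simp
  then have Mk: "M - k \<le> ?N" using n(1) y(5) by linarith
  obtain n' where n': "n' \<le> ?N" "(y k, ray i) \<in> adj E ^^ n'"
    using conn_set_diameter[OF Kp(1,2) y(6) Kp(3) reach, of "y k" "ray i"] by (auto simp: ray_edge_def)
  have "(y k, v) \<in> adj E ^^ (M - k)" using walk_relpow[of y E, OF y(1)] y(3,4) by (metis less_imp_le)
  then have "(v, y k) \<in> adj E ^^ (M - k)" by (rule adj_relpow_commute)
  then have "(v, ray i) \<in> adj E ^^ (M - k + n')" using n'(2) by (rule relpow_trans)
  then have "i \<le> M - k + n'" using gdist_le ray(3) by metis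
  also have "\<dots> \<le> 2 * ?N" using Mk n' by simp
  also have "\<dots> \<le> (2 * \<Delta> * half_cycle + 2) * card K"
  proof -
    have "card K \<ge> 1" using Kp by (auto simp: Suc_le_eq card_gt_0_iff)
    then show ?thesis by (simp add: algebra_simps)
  qed
  finally show ?thesis .
qed

sublocale separation E H \<Delta> ray_edge separates "2 * \<Delta> * half_cycle + 2"
  by unfold_locales (use ray(2) separates_size in \<open>auto simp: ray_edge_def\<close>)

lemma sep_event_eq: "sep_event = {\<omega> \<in> space (percolation E p). finite (cluster E \<omega> v)}"
proof -
  have "(\<exists>i. sep_at (vac \<omega>) i) \<longleftrightarrow> finite (cluster E \<omega> v)" for \<omega>
  proof
    assume "\<exists>i. sep_at (vac \<omega>) i"
    then obtain i where sep: "separates (reach H {ray_edge i} (vac \<omega>))" by (auto simp: sep_at_def)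
    let ?K = "reach H {ray_edge i} (vac \<omega>)"
    have K: "?K \<subseteq> vac \<omega>" by (rule reach_subset)
    \<comment> \<open>All edges of \<open>?K\<close> are vacant in \<open>\<omega>\<close>; opening
      every other edge can only enlarge the cluster.\<close>
    have "cluster E \<omega> v \<subseteq> cluster E (\<lambda>e. e \<notin> ?K) v"
    proof (rule cluster_subset[OF cluster_refl])
      fix x y assume "x \<in> cluster E (\<lambda>e. e \<notin> ?K) v" "{x, y} \<in> E" "\<omega> {x, y}"
      then show "y \<in> cluster E (\<lambda>e. e \<notin> ?K) v"
        using K by (elim cluster_step) (auto simp: vac_def)
    qed
    then show "finite (cluster E \<omega> v)" using sep finite_subset by (auto simp: separates_def)
  next
    assume "finite (cluster E \<omega> v)"
    then obtain D where D: "v \<notin> D" "conn_set D" "conn_set (V - D)" "finite (V - D)"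
      "\<And>e. e \<in> cut D \<Longrightarrow> \<not> \<omega> e" "\<exists>n. ray n \<in> D"
      by (rule finite_cluster_cut) blast
    \<comment> \<open>The ray starts at \<open>v\<close> outside \<open>D\<close> and visits
      \<open>D\<close>, so one of its edges lies in the cut and anchors the separating
      cluster.\<close>
    have "\<exists>i. ray i \<notin> D \<and> ray (Suc i) \<in> D"
    proof (rule ccontr)
      assume neg: "\<not> ?thesis"
      have "ray n \<notin> D" for n by (induction n) (use neg D(1) ray(1) in auto)
      then show False using D(6) by blast
    qed
    then obtain i where "ray i \<notin> D" "ray (Suc i) \<in> D" by auto
    then have i: "ray_edge i \<in> cut D" using ray(2) by (simp add: ray_edge_def cut_iff)
    have sub: "cut D \<subseteq> vac \<omega>" using D(5) by (auto simp: vac_def cut_def)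
    have "cut D \<subseteq> reach H {ray_edge i} (vac \<omega>)"
      using reach_mono_set[OF sub, of H "{ray_edge i}"] cut_connected[OF D(2,3) i] by simp
    then have "separates (reach H {ray_edge i} (vac \<omega>))"
      using D v by (intro cut_separates) auto
    then show "\<exists>i. sep_at (vac \<omega>) i" using i sub by (auto simp: sep_at_def)
  qed
  then show ?thesis by (simp add: sep_event_def space_percolation)
qed

section \<open>Measurability, and the passage from separation to \<open>theta\<close>\<close>

lemma in_cluster_event:
  "{\<omega> \<in> space (percolation E p). w \<in> cluster E \<omega> v} \<in> sets (percolation E p)"
proof -
  let ?r = "\<lambda>\<omega>. {(x, y). {x, y} \<in> E \<and> \<omega> {x, y}}"
  have 1: "{\<omega> \<in> space (percolation E p). (v, w) \<in> ?r \<omega> ^^ n} \<in> sets (percolation E p)" for n w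
  proof (induction n arbitrary: w)
    case (Suc n)
    let ?B = "{u \<in> V. {u, w} \<in> E}"
    have eq: "{\<omega> \<in> space (percolation E p). (v, w) \<in> ?r \<omega> ^^ Suc n} =
      (\<Union>u\<in>?B. {\<omega> \<in> space (percolation E p). (v, u) \<in> ?r \<omega> ^^ n} \<inter> {\<omega> \<in> space (percolation E p). \<omega> {u, w}})"
      using edges_sub by (auto simp: relcomp_unfold)
    have "countable ?B" using countable_V by (rule countable_subset[rotated]) auto
    moreover have "{\<omega> \<in> space (percolation E p). \<omega> e} \<in> sets (percolation E p)" if "e \<in> E" for e
      using measurable_edge[OF that] by (rule predE)
    ultimately show ?case
      unfolding eq using Suc.IH by (intro sets.countable_UN'' sets.Int) auto
  qed auto
  have "{\<omega> \<in> space (percolation E p). w \<in> cluster E \<omega> v} =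
      (\<Union>n. {\<omega> \<in> space (percolation E p). (v, w) \<in> ?r \<omega> ^^ n})"
    by (auto simp: cluster_def rtrancl_is_UN_relpow)
  then show ?thesis using 1 by auto
qed

text \<open>There are only countably many finite vertex sets, and the cluster is finite exactly when
  one of them contains it.\<close>

lemma finite_cluster_event:
  "{\<omega> \<in> space (percolation E p). finite (cluster E \<omega> v)} \<in> sets (percolation E p)"
proof -
  let ?F = "{A. finite A \<and> A \<subseteq> V}"
  have eq: "{\<omega> \<in> space (percolation E p). finite (cluster E \<omega> v)} =
    (\<Union>A\<in>?F. {\<omega> \<in> space (percolation E p). \<forall>w\<in>V - A. \<not> w \<in> cluster E \<omega> v})"
    (is "?L = ?R")
  proof
    show "?L \<subseteq> ?R"
    proof
      fix \<omega> assume "\<omega> \<in> ?L"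
      then show "\<omega> \<in> ?R" using cluster_V[of \<omega>] by (intro UN_I[of "cluster E \<omega> v"]) auto
    qed
    show "?R \<subseteq> ?L"
    proof
      fix \<omega> assume "\<omega> \<in> ?R"
      then obtain A where A: "finite A" "\<omega> \<in> space (percolation E p)" "\<forall>w\<in>V - A. w \<notin> cluster E \<omega> v"
        by auto
      then have "cluster E \<omega> v \<subseteq> A" using cluster_V[of \<omega>] by blast
      then show "\<omega> \<in> ?L" using A finite_subset by blast
    qed
  qed
  have "{\<omega> \<in> space (percolation E p). \<forall>w\<in>V - A. \<not> w \<in> cluster E \<omega> v} \<in> sets (percolation E p)" for A
  proof -
    have "{\<omega> \<in> space (percolation E p). \<forall>w\<in>V - A. \<not> w \<in> cluster E \<omega> v} =
      space (percolation E p) - (\<Union>w\<in>V - A. {\<omega> \<in> space (percolation E p). w \<in> cluster E \<omega> v})"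
      by auto
    also have "\<dots> \<in> sets (percolation E p)"
      using countable_V in_cluster_event by (intro sets.compl_sets sets.countable_UN'') auto
    finally show ?thesis .
  qed
  moreover have "countable ?F" using countable_V by (rule countable_Collect_finite_subset)
  ultimately show ?thesis unfolding eq by (intro sets.countable_UN'') auto
qed

lemma sep_event_sets: "sep_event \<in> sets (percolation E p)"
  unfolding sep_event_eq[of p] by (rule finite_cluster_event)

lemma theta_eq: "theta E v p = 1 - measure (percolation E p) sep_event"
proof -
  interpret prob_space "percolation E p" by (rule prob_space_percolation)
  have "{\<omega> \<in> space (percolation E p). infinite (cluster E \<omega> v)} = space (percolation E p) - sep_event"
    by (auto simp: sep_event_eq[of p])
  then show ?thesis unfolding theta_def using prob_compl[OF sep_event_sets] by simp
qed

lemma real_analytic_one_minus: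
  assumes "real_analytic_on f I"
  shows "real_analytic_on (\<lambda>p. 1 - f p) I"
  unfolding real_analytic_on_def
proof
  fix x assume "x \<in> I"
  then obtain r g where rg: "r > 0" "g holomorphic_on ball (complex_of_real x) r"
    "\<forall>y\<in>I. complex_of_real y \<in> ball (complex_of_real x) r \<longrightarrow> g (complex_of_real y) = complex_of_real (f y)"
    using assms by (auto simp: real_analytic_on_def)
  then show "\<exists>r>0. \<exists>g. g holomorphic_on ball (complex_of_real x) r \<and>
      (\<forall>y\<in>I. complex_of_real y \<in> ball (complex_of_real x) r \<longrightarrow> g (complex_of_real y) = complex_of_real (1 - f y))"
    by (intro exI[of _ r] conjI exI[of _ "\<lambda>z. 1 - g z"]) (auto intro!: holomorphic_intros)
qed

text \<open>\<open>\<Delta>\<close> uses truncated subtraction on naturals; \<open>deg_ge_2\<close>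
  guarantees agreement with the real expression.\<close>

lemma gamma_eq: "gamma_pres S R = growth"
proof -
  have "real \<Delta> = (2 * real deg - 2) ^ half_cycle"
    using deg_ge_2 by (simp add: \<Delta>_def of_nat_diff)
  then show ?thesis by (simp add: gamma_pres_def half_cycle_def Let_def)
qed

lemma p_analytic_le: "p_analytic E v \<le> 1 - 1 / gamma_pres S R"
  unfolding p_analytic_def
proof (rule cInf_lower)
  have "real_analytic_on (theta E v) {1 - 1 / growth<..1}"
    using real_analytic_one_minus[OF analytic_sep_event[OF sep_event_sets]] by (simp add: theta_eq[abs_def])
  then show "1 - 1 / gamma_pres S R \<in> {p. 0 \<le> p \<and> p \<le> 1 \<and> real_analytic_on (theta E v) {p<..1}}"
    using growth_ge_1 by (simp add: gamma_eq)
qed (auto simp: bdd_below_def)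

end

theorem theorem10p12:
  fixes S :: "'a set" and R :: "'a gword set" and v :: "'a gword set"
  assumes "finite S" and "finite R" and "R \<subseteq> words S"
    and "relators_induce_cycles S R"
    and "infinite (carrier (presented_group S R))"
    and "one_ended (cayley_graph S R)"
    and "v \<in> carrier (presented_group S R)"
  shows "p_analytic (cayley_graph S R) v \<le> 1 - 1 / gamma_pres S R"
proof -
  interpret one_ended_presentation S R v
    by unfold_locales (use assms in auto)
  show ?thesis by (rule p_analytic_le)
qed

end
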